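(* Every cobipartite graph $G$ that has no induced subgraph isomorphic to $\overline{2P_3}$ and whose complement $\overline{G}$ is right-Sperner has clique-width at most $5$. Moreover, given such a graph $G$, one can compute a $5$-expression of $G$ in time $\mathcal{O}(|V(G)|^4)$.
   Context: A graph is cobipartite if its complement is bipartite. A bipartite graph is right-Sperner if it has a bipartition $(A,B)$ into independent sets such that for all $u,v\in B$, $N(u)\subseteq N(v)$ implies $u=v$. $2P_3$ is the disjoint union of two 3-vertex paths and $\overline{2P_3}$ its complement. A $k$-graph is a graph with vertex labels from $\{1,\dots,k\}$. A $k$-expression is an expression built from: $i(v)$ (create vertex $v$ with label $i$), $\oplus$ (disjoint union), $\rho_{i\to j}$ (relabel label $i$ to $j$), and $\eta_{i,j}$ for $i\ne j$ (add all edges between vertices labeled $i$ and $j$). The clique-width of $G$ is the least $k$ such that some $k$-expression produces a $k$-graph isomorphic to $G$. *)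

theory Defs
  imports Complex_Main "HOL-Library.Landau_Symbols"
begin

section \<open>Finite simple graphs\<close>

record 'a ugraph =
  verts :: "'a set"
  edges :: "'a set set"

definition simple_graph :: "'a ugraph \<Rightarrow> bool" where
  "simple_graph G \<longleftrightarrow> finite (verts G) \<and>
     (\<forall>e \<in> edges G. \<exists>u \<in> verts G. \<exists>v \<in> verts G. u \<noteq> v \<and> e = {u, v})"

definition nbhd :: "'a ugraph \<Rightarrow> 'a \<Rightarrow> 'a set" where
  "nbhd G u = {v \<in> verts G. {u, v} \<in> edges G}"

definition graph_compl :: "'a ugraph \<Rightarrow> 'a ugraph" where
  "graph_compl G = \<lparr> verts = verts G,
     edges = {{u, v} | u v. u \<in> verts G \<and> v \<in> verts G \<and> u \<noteq> v \<and> {u, v} \<notin> edges G} \<rparr>"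

definition induced :: "'a ugraph \<Rightarrow> 'a set \<Rightarrow> 'a ugraph" where
  "induced G S = \<lparr> verts = S, edges = {e \<in> edges G. e \<subseteq> S} \<rparr>"

definition graph_iso :: "'a ugraph \<Rightarrow> 'b ugraph \<Rightarrow> bool" where
  "graph_iso G H \<longleftrightarrow> (\<exists>f. bij_betw f (verts G) (verts H) \<and>
     (\<forall>u \<in> verts G. \<forall>v \<in> verts G. {u, v} \<in> edges G \<longleftrightarrow> {f u, f v} \<in> edges H))"

definition has_induced :: "'a ugraph \<Rightarrow> 'b ugraph \<Rightarrow> bool" where
  "has_induced G H \<longleftrightarrow> (\<exists>S \<subseteq> verts G. graph_iso (induced G S) H)"

definition path_graph :: "nat \<Rightarrow> nat ugraph" where
  "path_graph n = \<lparr> verts = {..<n}, edges = {{i, Suc i} | i. Suc i < n} \<rparr>"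

definition disj_union :: "'a ugraph \<Rightarrow> 'b ugraph \<Rightarrow> ('a + 'b) ugraph" where
  "disj_union G H = \<lparr> verts = verts G <+> verts H,
     edges = (\<lambda>e. Inl ` e) ` edges G \<union> (\<lambda>e. Inr ` e) ` edges H \<rparr>"

definition two_P3 :: "(nat + nat) ugraph" where
  "two_P3 = disj_union (path_graph 3) (path_graph 3)"

text \<open>The parts of a bipartition may be empty.\<close>

definition bipartition :: "'a ugraph \<Rightarrow> 'a set \<Rightarrow> 'a set \<Rightarrow> bool" where
  "bipartition G A B \<longleftrightarrow> A \<union> B = verts G \<and> A \<inter> B = {} \<and>
     (\<forall>u \<in> A. \<forall>v \<in> A. {u, v} \<notin> edges G) \<and>
     (\<forall>u \<in> B. \<forall>v \<in> B. {u, v} \<notin> edges G)"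

definition bipartite :: "'a ugraph \<Rightarrow> bool" where
  "bipartite G \<longleftrightarrow> (\<exists>A B. bipartition G A B)"

definition cobipartite :: "'a ugraph \<Rightarrow> bool" where
  "cobipartite G \<longleftrightarrow> bipartite (graph_compl G)"

definition right_Sperner :: "'a ugraph \<Rightarrow> bool" where
  "right_Sperner G \<longleftrightarrow> (\<exists>A B. bipartition G A B \<and>
     (\<forall>u \<in> B. \<forall>v \<in> B. nbhd G u \<subseteq> nbhd G v \<longrightarrow> u = v))"


section \<open>Expressions and clique-width\<close>

datatype 'a cw_expr =
    Create nat 'a
  | Disjoint_Union "'a cw_expr" "'a cw_expr"
  | Relabel nat nat "'a cw_expr"
  | Join nat nat "'a cw_expr"

record 'a lgraph = "'a ugraph" +
  label :: "'a \<Rightarrow> nat"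

text \<open>The labelling of the constructed graph is relevant only on its vertices.\<close>

fun cw_graph :: "'a cw_expr \<Rightarrow> 'a lgraph" where
  "cw_graph (Create i v) = \<lparr> verts = {v}, edges = {}, label = (\<lambda>_. i) \<rparr>"
| "cw_graph (Disjoint_Union d e) = (let G = cw_graph d; H = cw_graph e in
     \<lparr> verts = verts G \<union> verts H, edges = edges G \<union> edges H,
       label = (\<lambda>v. if v \<in> verts G then label G v else label H v) \<rparr>)"
| "cw_graph (Relabel i j e) = (let G = cw_graph e in
     G\<lparr> label := (\<lambda>v. if label G v = i then j else label G v) \<rparr>)"
| "cw_graph (Join i j e) = (let G = cw_graph e in
     G\<lparr> edges := edges G \<union>
        {{u, v} | u v. u \<in> verts G \<and> v \<in> verts G \<and> label G u = i \<and> label G v = j} \<rparr>)"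

fun k_expression :: "nat \<Rightarrow> 'a cw_expr \<Rightarrow> bool" where
  "k_expression k (Create i v) \<longleftrightarrow> i \<in> {1..k}"
| "k_expression k (Disjoint_Union d e) \<longleftrightarrow> k_expression k d \<and> k_expression k e \<and>
     verts (cw_graph d) \<inter> verts (cw_graph e) = {}"
| "k_expression k (Relabel i j e) \<longleftrightarrow> i \<in> {1..k} \<and> j \<in> {1..k} \<and> k_expression k e"
| "k_expression k (Join i j e) \<longleftrightarrow> i \<in> {1..k} \<and> j \<in> {1..k} \<and> i \<noteq> j \<and> k_expression k e"

definition expr_graph :: "'a cw_expr \<Rightarrow> 'a ugraph" where
  "expr_graph e = \<lparr> verts = verts (cw_graph e), edges = edges (cw_graph e) \<rparr>"

text \<open>The vertex names in the expressions may be taken from the vertex type of the graph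
  itself, since the graph is among its own isomorphic copies.  No expression produces the graph
  without vertices, so this is meaningful for nonempty finite graphs only.\<close>

definition clique_width :: "'a ugraph \<Rightarrow> nat" where
  "clique_width G =
     (LEAST k. \<exists>e :: 'a cw_expr. k_expression k e \<and> graph_iso (expr_graph e) G)"


section \<open>Model of computation\<close>

text \<open>
  Running time refers to a random access machine with uniform cost.  Its programs are
  structured and work on finitely many named arrays of natural numbers; an ordinary variable is
  cell 0 of an array.  The arithmetic is that of the RAM of Cook and Reckhow: addition,
  (truncated) subtraction and comparison at unit cost, and no multiplication.
  Comparisons return 0 or 1, and tests treat a nonzero value as true.
\<close>

type_synonym store = "string \<Rightarrow> nat \<Rightarrow> nat"

datatype rexp =
    Const nat
  | Read string rexp
  | Add rexp rexp
  | Sub rexp rexp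
  | Less rexp rexp
  | Equal rexp rexp

fun rval :: "rexp \<Rightarrow> store \<Rightarrow> nat" where
  "rval (Const c) s = c"
| "rval (Read x a) s = s x (rval a s)"
| "rval (Add a b) s = rval a s + rval b s"
| "rval (Sub a b) s = rval a s - rval b s"
| "rval (Less a b) s = of_bool (rval a s < rval b s)"
| "rval (Equal a b) s = of_bool (rval a s = rval b s)"

fun rcost :: "rexp \<Rightarrow> nat" where
  "rcost (Const c) = 1"
| "rcost (Read x a) = 1 + rcost a"
| "rcost (Add a b) = 1 + rcost a + rcost b"
| "rcost (Sub a b) = 1 + rcost a + rcost b"
| "rcost (Less a b) = 1 + rcost a + rcost b"
| "rcost (Equal a b) = 1 + rcost a + rcost b"

datatype prog =
    Skip
  | Write string rexp rexp
  | Seq prog prog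
  | Cond rexp prog prog
  | Loop rexp prog

definition store_upd :: "store \<Rightarrow> string \<Rightarrow> nat \<Rightarrow> nat \<Rightarrow> store" where
  "store_upd s x i v = s(x := (s x)(i := v))"

text \<open>\<open>run p s t s'\<close>: started in store \<open>s\<close>, program \<open>p\<close> halts after \<open>t\<close> steps in store \<open>s'\<close>.\<close>

inductive run :: "prog \<Rightarrow> store \<Rightarrow> nat \<Rightarrow> store \<Rightarrow> bool" where
  run_Skip: "run Skip s 1 s"
| run_Write: "run (Write x a b) s (1 + rcost a + rcost b) (store_upd s x (rval a s) (rval b s))"
| run_Seq: "run p s t s' \<Longrightarrow> run q s' t' s'' \<Longrightarrow> run (Seq p q) s (t + t') s''"
| run_Cond_True: "rval b s \<noteq> 0 \<Longrightarrow> run p s t s' \<Longrightarrow> run (Cond b p q) s (1 + rcost b + t) s'"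
| run_Cond_False: "rval b s = 0 \<Longrightarrow> run q s t s' \<Longrightarrow> run (Cond b p q) s (1 + rcost b + t) s'"
| run_Loop_True: "rval b s \<noteq> 0 \<Longrightarrow> run p s t s' \<Longrightarrow> run (Loop b p) s' t' s'' \<Longrightarrow>
    run (Loop b p) s (1 + rcost b + t + t') s''"
| run_Loop_False: "rval b s = 0 \<Longrightarrow> run (Loop b p) s (1 + rcost b) s"

inductive_cases run_SkipE: "run Skip s t s'"
inductive_cases run_WriteE: "run (Write x a b) s t s'"
inductive_cases run_SeqE: "run (Seq p q) s t s'"
inductive_cases run_CondE: "run (Cond b p q) s t s'"
inductive_cases run_LoopE: "run (Loop b p) s t s'"

lemma run_deterministic:
  "run p s t s' \<Longrightarrow> run p s u s'' \<Longrightarrow> t = u \<and> s' = s''"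
proof (induction arbitrary: u s'' rule: run.induct)
  case run_Skip
  then show ?case by (auto elim: run_SkipE)
next
  case run_Write
  then show ?case by (auto elim: run_WriteE)
next
  case (run_Seq p s t s1 q t' s2)
  from run_Seq.prems obtain t1 sa t2
    where *: "run p s t1 sa" "run q sa t2 s''" "u = t1 + t2"
    by (rule run_SeqE)
  from run_Seq.IH(1)[OF *(1)] run_Seq.IH(2) * show ?case
    by simp
next
  case (run_Cond_True b s p t s' q)
  from run_Cond_True.prems run_Cond_True.hyps(1) obtain t1
    where *: "run p s t1 s''" "u = 1 + rcost b + t1"
    by (auto elim: run_CondE)
  from run_Cond_True.IH[OF *(1)] * show ?case
    by simp
next
  case (run_Cond_False b s q t s' p)
  from run_Cond_False.prems run_Cond_False.hyps(1) obtain t1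
    where *: "run q s t1 s''" "u = 1 + rcost b + t1"
    by (auto elim: run_CondE)
  from run_Cond_False.IH[OF *(1)] * show ?case
    by simp
next
  case (run_Loop_True b s p t s1 t' s2)
  obtain t1 sa t2
    where *: "run p s t1 sa" "run (Loop b p) sa t2 s''" "u = Suc (rcost b + t1 + t2)"
    by (rule run_LoopE[OF run_Loop_True.prems]) (use run_Loop_True.hyps(1) that in blast)+
  from run_Loop_True.IH(1)[OF *(1)] run_Loop_True.IH(2) * show ?case
    by simp
next
  case (run_Loop_False b s p)
  show ?case
    by (rule run_LoopE[OF run_Loop_False.prems]) (use run_Loop_False.hyps in simp_all)
qed

text \<open>An input graph has vertices \<open>0, \<dots>, n - 1\<close> and is given by \<open>n\<close> and its adjacency matrix,
  stored row by row; all other cells are initially 0.\<close>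

definition input_store :: "nat ugraph \<Rightarrow> store" where
  "input_store G = (\<lambda>x i.
     let n = card (verts G) in
     if x = ''n'' \<and> i = 0 then n
     else if x = ''adj'' \<and> i < n * n then of_bool ({i div n, i mod n} \<in> edges G)
     else 0)"

text \<open>Expressions are output in prefix notation.\<close>

fun encode :: "nat cw_expr \<Rightarrow> nat list" where
  "encode (Create i v) = [0, i, v]"
| "encode (Disjoint_Union d e) = 1 # encode d @ encode e"
| "encode (Relabel i j e) = 2 # i # j # encode e"
| "encode (Join i j e) = 3 # i # j # encode e"

lemma encode_prefix_free: "encode d @ xs = encode e @ ys \<Longrightarrow> d = e \<and> xs = ys"
proof (induction d arbitrary: e xs ys)
  case (Create i v)
  then show ?case by (cases e) auto
next
  case (Disjoint_Union d1 d2)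
  from Disjoint_Union.prems obtain e1 e2 where e: "e = Disjoint_Union e1 e2"
    by (cases e) auto
  with Disjoint_Union.prems
  have *: "encode d1 @ (encode d2 @ xs) = encode e1 @ (encode e2 @ ys)"
    by simp
  from Disjoint_Union.IH(1)[OF *] have "d1 = e1" "encode d2 @ xs = encode e2 @ ys"
    by auto
  with Disjoint_Union.IH(2) e show ?case
    by blast
next
  case (Relabel i j d)
  from Relabel.prems obtain e' where e: "e = Relabel i j e'" "encode d @ xs = encode e' @ ys"
    by (cases e) auto
  from Relabel.IH[OF e(2)] e(1) show ?case
    by blast
next
  case (Join i j d)
  from Join.prems obtain e' where e: "e = Join i j e'" "encode d @ xs = encode e' @ ys"
    by (cases e) auto
  from Join.IH[OF e(2)] e(1) show ?case
    by blast
qed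

definition output_is :: "store \<Rightarrow> nat cw_expr \<Rightarrow> bool" where
  "output_is s e \<longleftrightarrow> s ''outlen'' 0 = length (encode e) \<and>
     (\<forall>i < length (encode e). s ''out'' i = encode e ! i)"

text \<open>One program handles all inputs from \<open>C\<close>, and its running time is bounded by \<open>T\<close> as a
  function of the number of vertices.  The expression must produce the input graph itself, with
  the given vertex names, not just an isomorphic copy.\<close>

definition computes_k_expressions_in_time ::
    "nat \<Rightarrow> nat ugraph set \<Rightarrow> prog \<Rightarrow> (nat \<Rightarrow> nat) \<Rightarrow> bool" where
  "computes_k_expressions_in_time k C p T \<longleftrightarrow>
     (\<forall>G \<in> C. verts G = {..<card (verts G)} \<longrightarrow>
        (\<exists>t s e. run p (input_store G) t s \<and> t \<le> T (card (verts G)) \<and>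
           output_is s e \<and> k_expression k e \<and> expr_graph e = G))"

end

theory Submission
  imports Defs
begin

text \<open>
  Let \<open>A\<close>, \<open>B\<close> be the two cliques of \<open>G\<close>, and attach to every \<open>b \<in> B\<close> the set of its
  non-neighbours in \<open>A\<close>.  The Sperner property makes these sets an antichain, and the excluded
  subgraph makes them 1-Sperner: of the two differences of any two members, one is a singleton.
  Boros, Gurvich and Milanic showed that such a family has a pivot, an element \<open>z\<close> such that
  \<open>e - f = {z}\<close> for all members \<open>e\<close>, \<open>f\<close> with \<open>z \<in> e\<close> and \<open>z \<notin> f\<close>.  Removing \<open>z\<close> splits the
  graph into two smaller graphs of the same kind whose mutual adjacencies depend only on the sides
  of the vertices, so two labels for each of them and a fifth one for \<open>z\<close> suffice to glue them.

  A pivot is found by testing every vertex in quadratic time, and there are at most \<open>n\<close> pivots,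
  which gives the bound \<open>O(n^4)\<close>.  The input does not come with a bipartition, but one can be
  fixed without search: a vertex whose non-neighbours are all non-neighbours of some other vertex
  can be assumed to lie in \<open>A\<close>, and conversely every bipartition with all these vertices in \<open>A\<close> is right-Sperner.
\<close>

section \<open>Pivots of 1-Sperner families\<close>

text \<open>At a pivot \<open>z\<close> the left part takes the vertices of \<open>B\<close> whose
  sets contain \<open>z\<close>, together with the other vertices of \<open>A\<close> in these sets.
  A left vertex of \<open>B\<close> then has no right vertex of \<open>A\<close> in its set. A left
  vertex \<open>a\<close> of \<open>A\<close> is in the set \<open>f\<close> of every right vertex
  of \<open>B\<close>: some left set \<open>e\<close> contains both \<open>a\<close> and
  \<open>z\<close>, and \<open>e - f = {z}\<close> forces \<open>a \<in> f\<close>. Hence the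
  differences of two sets from the same part lie in that part, and both parts are 1-Sperner again.
  The machine has no recursion, so the pending parts form a stack held in one array of levels.
  Prefix notation allows the operators of a split to be written before its parts are processed, so
  the output is never revised. The price is that an intermediate output codes no expression; the
  invariant instead says that arbitrary expressions for the pending parts complete it. Loops of
  exactly \<open>n\<close> rounds suffice because each round of the colouring settles a vertex while
  any is uncoloured, and each round of the decomposition removes one.\<close>

text \<open>The pivot is the element of \<open>e - f\<close> for a smallest member \<open>e\<close> and a largest other member \<open>f\<close>.\<close>

lemma one_Sperner_pivot:
  fixes N :: "'b \<Rightarrow> 'a set"
  assumes "finite I" "V \<noteq> {}"
    and fin: "\<And>b. b \<in> I \<Longrightarrow> finite (N b)"
    and sub: "\<And>b. b \<in> I \<Longrightarrow> N b \<subseteq> V"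
    and sperner: "\<And>b c. b \<in> I \<Longrightarrow> c \<in> I \<Longrightarrow> b \<noteq> c \<Longrightarrow> \<not> N b \<subseteq> N c"
    and one: "\<And>b c. b \<in> I \<Longrightarrow> c \<in> I \<Longrightarrow> b \<noteq> c \<Longrightarrow> card (N b - N c) = 1 \<or> card (N c - N b) = 1"
  shows "\<exists>z\<in>V. \<forall>b\<in>I. \<forall>c\<in>I. z \<in> N b \<longrightarrow> z \<notin> N c \<longrightarrow> N b - N c = {z}"
proof (cases "\<exists>b\<in>I. \<exists>c\<in>I. b \<noteq> c")
  \<comment> \<open>With at most one member the condition on \<open>z\<close> is vacuous, so any
    element of \<open>V\<close> serves.\<close>
  case False
  with \<open>V \<noteq> {}\<close> show ?thesis by (metis ex_in_conv)
next
  case True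
  define w where "w b = card (N b)" for b
  \<comment> \<open>If \<open>N b\<close> is not larger than \<open>N c\<close>, then
    \<open>N b - N c\<close> is not larger than \<open>N c - N b\<close>; being nonempty, it is
    itself the singleton.\<close>
  have single: "\<exists>z. N b - N c = {z}"
    if "b \<in> I" "c \<in> I" "b \<noteq> c" "w b \<le> w c" for b c
  proof -
    have "card (N b - N c) + card (N b \<inter> N c) = card (N b)"
      "card (N c - N b) + card (N b \<inter> N c) = card (N c)"
      using fin that by (metis Int_commute add.commute card_Diff_subset_Int card_mono finite_Int
          inf_le1 le_add_diff_inverse)+
    moreover have "card (N b) \<le> card (N c)" using that w_def by simp
    moreover have "card (N b - N c) \<noteq> 0"
      using sperner[of b c] fin that by auto
    ultimately have "card (N b - N c) = 1"
      using one[of b c] that by linarith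
    then show ?thesis by (auto simp: card_1_singleton_iff)
  qed
  have single': "N b - N c = {z}"
    if "b \<in> I" "c \<in> I" "z \<in> N b" "z \<notin> N c" "w b \<le> w c" for b c z
  proof -
    have "b \<noteq> c" using that by auto
    then show ?thesis using single[of b c] that by (metis DiffI singletonD)
  qed
  have "Min (w ` I) \<in> w ` I"
    using True \<open>finite I\<close> by (intro Min_in) auto
  then obtain e where e: "e \<in> I" "w e = Min (w ` I)" by auto
  have e_le: "w e \<le> w b" if "b \<in> I" for b
    using that e \<open>finite I\<close> by simp
  have "Max (w ` (I - {e})) \<in> w ` (I - {e})"
    using True \<open>finite I\<close> by (intro Max_in) auto
  then obtain f where "Max (w ` (I - {e})) = w f" "f \<in> I - {e}" by (rule imageE)
  then have f: "f \<in> I" "f \<noteq> e" "w f = Max (w ` (I - {e}))" by auto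
  \<comment> \<open>The maximum omits \<open>e\<close>, but \<open>e\<close> has minimal size, so
    the bound covers it as well.\<close>
  have f_ge: "w b \<le> w f" if "b \<in> I" for b
    using that e_le[OF f(1)] f \<open>finite I\<close> by (cases "b = e") auto
  obtain z where z: "N e - N f = {z}"
    using single[of e f] e(1) f(1,2) e_le by blast
  have "N b - N c = {z}" if bc: "b \<in> I" "c \<in> I" "z \<in> N b" "z \<notin> N c" for b c
  proof -
    have ne: "b \<noteq> c" "b \<noteq> f" "e \<noteq> c" using bc z by auto
    have ec: "N e - N c = {z}"
      using single'[OF e(1) bc(2) _ bc(4)] e_le[OF bc(2)] z by blast
    show ?thesis
    proof (cases "card (N b - N c) = 1")
      case True
      then show ?thesis using bc by (metis DiffI card_1_singletonE singletonD)
    next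
      \<comment> \<open>Here \<open>c\<close> turns out to be \<open>f\<close>. The one element
        \<open>x\<close> of \<open>N e - N b\<close> lies in \<open>N c\<close> and
        \<open>N f\<close>, so \<open>N c\<close> is contained in \<open>N b\<close> together with
        \<open>x\<close> and misses \<open>z\<close>, while \<open>N b\<close> without
        \<open>z\<close> lies in \<open>N f\<close>. Thus \<open>N c \<subseteq> N f\<close>, and
        the antichain property applies.\<close>
      case False
      with one[OF bc(1,2)] ne have "card (N c - N b) = 1" by blast
      then obtain y where y: "N c - N b = {y}" by (auto simp: card_1_singleton_iff)
      have "b \<noteq> e" using False ec by auto
      then obtain x where x: "N e - N b = {x}"
        using single[of e b] e e_le bc by auto
      have "x \<noteq> z" using x bc by auto
      then have "x \<in> N c" "x \<in> N f" using x ec z by auto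
      then have "y = x" using x y by auto
      have bf: "N b - N f = {z}"
        using single'[OF bc(1) f(1) bc(3)] f_ge[OF bc(1)] z by blast
      have "N c \<subseteq> N f"
      proof
        fix a assume a: "a \<in> N c"
        then have "a = x \<or> a \<in> N b" using y \<open>y = x\<close> by auto
        moreover have "a \<noteq> z" using a bc by auto
        ultimately show "a \<in> N f" using bf \<open>x \<in> N f\<close> by auto
      qed
      then have "c = f" using sperner bc f by blast
      then show ?thesis using bf by simp
    qed
  qed
  moreover have "z \<in> V" using z sub[of e] e by auto
  ultimately show ?thesis by blast
qed

section \<open>Splitting a cobipartite graph at a pivot\<close>

text \<open>Adjacency in the complement. With \<open>u \<noteq> v\<close> built in, a clique is
  exactly a set without such pairs.\<close>

definition nonadj :: "'a set set \<Rightarrow> 'a \<Rightarrow> 'a \<Rightarrow> bool" where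
  "nonadj E u v \<longleftrightarrow> u \<noteq> v \<and> {u, v} \<notin> E"

lemma nonadj_sym: "nonadj E u v \<longleftrightarrow> nonadj E v u"
  by (auto simp: nonadj_def insert_commute)

lemma nonadj_swap:
  "nonadj E u v \<Longrightarrow> nonadj E v u" "\<not> nonadj E u v \<Longrightarrow> \<not> nonadj E v u"
  by (simp_all add: nonadj_sym)

lemma nonadj_irrefl [simp]: "\<not> nonadj E u u"
  by (simp add: nonadj_def)

text \<open>While two expressions are being glued, labels 1 and 2 mark the sides \<open>A\<close> and \<open>B\<close> of the right
  part, labels 3 and 4 those of the left part, and label 5 marks the pivot.\<close>

definition shift_lab :: "'a cw_expr \<Rightarrow> 'a cw_expr" where
  "shift_lab e = Relabel 1 3 (Relabel 2 4 e)"

text \<open>The six joins are the pairs of classes that are completely adjacent. Pairs 1, 2 and 3, 4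
  lie within one part and already have their edges. Pairs 2, 3 and 4, 5 have no edges at all: left
  vertices of \<open>A\<close> against right vertices of \<open>B\<close>, and left vertices of
  \<open>B\<close> against the pivot.\<close>

definition glue :: "'a cw_expr \<Rightarrow> 'a cw_expr" where
  "glue e = Relabel 5 1 (Relabel 4 2 (Relabel 3 1 (Join 1 3 (Join 2 4 (Join 1 4
     (Join 1 5 (Join 3 5 (Join 2 5 e))))))))"

locale cobip =
  fixes E :: "'a set set" and A B :: "'a set"
  assumes fin: "finite A" "finite B"
    and disj: "A \<inter> B = {}"
    and edge: "\<And>d. d \<in> E \<Longrightarrow> \<exists>u v. u \<noteq> v \<and> d = {u, v}"
    and cliqueA: "\<And>u v. u \<in> A \<Longrightarrow> v \<in> A \<Longrightarrow> \<not> nonadj E u v"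
    and cliqueB: "\<And>u v. u \<in> B \<Longrightarrow> v \<in> B \<Longrightarrow> \<not> nonadj E u v"
begin

text \<open>The difference \<open>e - f\<close> of the members attached to \<open>b\<close> and
  \<open>c\<close>, within the part \<open>S\<close>.\<close>

definition diffN :: "'a set \<Rightarrow> 'a \<Rightarrow> 'a \<Rightarrow> 'a set" where
  "diffN S b c = {a \<in> A \<inter> S. nonadj E b a \<and> \<not> nonadj E c a}"

definition one_Sperner :: "'a set \<Rightarrow> bool" where
  "one_Sperner S \<longleftrightarrow> (\<forall>b \<in> B \<inter> S. \<forall>c \<in> B \<inter> S. b \<noteq> c \<longrightarrow>
     diffN S b c \<noteq> {} \<and> (card (diffN S b c) = 1 \<or> card (diffN S c b) = 1))"

text \<open>The condition \<open>e - f = {z}\<close> for all \<open>e\<close>, \<open>f\<close> with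
  \<open>z \<in> e\<close>, \<open>z \<notin> f\<close>, read off one further element
  \<open>x\<close> at a time: no such \<open>e\<close> contains \<open>x\<close> while such an
  \<open>f\<close> misses it. For fixed \<open>x\<close> this is two independent searches through
  \<open>B\<close> instead of one through pairs, which is why a pivot test is quadratic.\<close>

definition pivot :: "'a set \<Rightarrow> 'a \<Rightarrow> bool" where
  "pivot S z \<longleftrightarrow> z \<in> A \<inter> S \<and> (\<forall>x \<in> A \<inter> S. x \<noteq> z \<longrightarrow>
     \<not> ((\<exists>b \<in> B \<inter> S. nonadj E b z \<and> nonadj E b x) \<and>
        (\<exists>b \<in> B \<inter> S. \<not> nonadj E b z \<and> \<not> nonadj E b x)))"

text \<open>Since \<open>B\<close> is a clique, a vertex \<open>x\<close> of \<open>B\<close> enters the left part only through \<open>b = x\<close>.\<close>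

definition lpart :: "'a set \<Rightarrow> 'a \<Rightarrow> 'a set" where
  "lpart S z = {x \<in> S. x \<noteq> z \<and> (\<exists>b \<in> B \<inter> S. nonadj E b z \<and> (nonadj E b x \<or> b = x))}"

definition rpart :: "'a set \<Rightarrow> 'a \<Rightarrow> 'a set" where
  "rpart S z = S - {z} - lpart S z"

definition lab :: "'a \<Rightarrow> nat" where
  "lab v = (if v \<in> A then 1 else 2)"

text \<open>The edge set \<open>E\<close> stays fixed and a part is given by its vertices alone.
  Prescribing the sides as final labels makes realized parts ready for the next gluing.\<close>

definition realizes :: "'a set \<Rightarrow> 'a cw_expr \<Rightarrow> bool" where
  "realizes S e \<longleftrightarrow> k_expression 5 e \<and> verts (cw_graph e) = S \<and>
     edges (cw_graph e) = {d \<in> E. d \<subseteq> S} \<and> (\<forall>v \<in> S. label (cw_graph e) v = lab v)"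

lemma pivot_exists:
  assumes "one_Sperner S" "A \<inter> S \<noteq> {}"
  shows "\<exists>z. pivot S z"
proof -
  define N where "N b = {a \<in> A \<inter> S. nonadj E b a}" for b
  have N: "N b - N c = diffN S b c" for b c
    by (auto simp: N_def diffN_def)
  have "\<exists>z\<in>A \<inter> S. \<forall>b\<in>B \<inter> S. \<forall>c\<in>B \<inter> S. z \<in> N b \<longrightarrow> z \<notin> N c \<longrightarrow> N b - N c = {z}"
  proof (rule one_Sperner_pivot)
    fix b c assume bc: "b \<in> B \<inter> S" "c \<in> B \<inter> S" "b \<noteq> c"
    then have "diffN S b c \<noteq> {}" "card (diffN S b c) = 1 \<or> card (diffN S c b) = 1"
      using assms(1) unfolding one_Sperner_def by blast+
    then show "\<not> N b \<subseteq> N c" "card (N b - N c) = 1 \<or> card (N c - N b) = 1"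
      unfolding N using N[of b c] by auto
  qed (use fin assms in \<open>auto simp: N_def\<close>)
  then obtain z where z: "z \<in> A \<inter> S"
    "\<And>b c. b \<in> B \<inter> S \<Longrightarrow> c \<in> B \<inter> S \<Longrightarrow> z \<in> N b \<Longrightarrow> z \<notin> N c \<Longrightarrow> N b - N c = {z}" by blast
  have "pivot S z"
    unfolding pivot_def
  proof (intro conjI ballI impI notI)
    fix x assume x: "x \<in> A \<inter> S" "x \<noteq> z" "(\<exists>b \<in> B \<inter> S. nonadj E b z \<and> nonadj E b x) \<and>
        (\<exists>b \<in> B \<inter> S. \<not> nonadj E b z \<and> \<not> nonadj E b x)"
    then obtain b c where "b \<in> B \<inter> S" "nonadj E b z" "nonadj E b x"
        "c \<in> B \<inter> S" "\<not> nonadj E c z" "\<not> nonadj E c x" by blast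
    with z(2)[of b c] x z(1) show False by (auto simp: N_def)
  qed (use z in auto)
  then show ?thesis ..
qed

text \<open>Without vertices of \<open>A\<close> all differences are empty, so the antichain
  property leaves room for only one vertex of \<open>B\<close>.\<close>

lemma one_Sperner_no_A:
  assumes "one_Sperner S" "A \<inter> S = {}" "S \<subseteq> A \<union> B" "z \<in> S"
  shows "S = {z}"
proof -
  have "diffN S b c = {}" for b c using assms(2) by (auto simp: diffN_def)
  then show ?thesis using assms unfolding one_Sperner_def by blast
qed

lemma one_Sperner_subset:
  assumes "one_Sperner S" "T \<subseteq> S"
    and "\<And>b c. b \<in> B \<Longrightarrow> c \<in> B \<Longrightarrow> b \<in> T \<Longrightarrow> c \<in> T \<Longrightarrow> diffN T b c = diffN S b c"
  shows "one_Sperner T"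
  unfolding one_Sperner_def
proof (intro ballI impI)
  fix b c assume "b \<in> B \<inter> T" "c \<in> B \<inter> T" "b \<noteq> c"
  then show "diffN T b c \<noteq> {} \<and> (card (diffN T b c) = 1 \<or> card (diffN T c b) = 1)"
    using assms(1)[unfolded one_Sperner_def, rule_format, of b c] assms(2,3) by auto
qed

context
  fixes S z
  assumes S: "S \<subseteq> A \<union> B" and pivot: "pivot S z"
begin

lemma z_in: "z \<in> A" "z \<in> S" using pivot by (auto simp: pivot_def)

lemma lpart_B: "x \<in> B \<Longrightarrow> x \<in> lpart S z \<longleftrightarrow> x \<in> S \<and> nonadj E x z"
  using cliqueB z_in disj by (auto simp: lpart_def)

lemma lpart_A:
  "x \<in> A \<Longrightarrow> x \<in> lpart S z \<longleftrightarrow> x \<in> S \<and> x \<noteq> z \<and> (\<exists>b \<in> B \<inter> S. nonadj E b z \<and> nonadj E b x)"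
  using disj by (auto simp: lpart_def)

lemma parts: "S = insert z (lpart S z \<union> rpart S z)" "z \<notin> lpart S z" "z \<notin> rpart S z"
  "lpart S z \<inter> rpart S z = {}" "lpart S z \<subseteq> S" "rpart S z \<subseteq> S"
  using z_in by (auto simp: lpart_def rpart_def)

text \<open>Since \<open>b\<close> is a non-neighbour of the pivot, any non-neighbour of
  \<open>b\<close> in \<open>A\<close> other than the pivot is itself in the left part.\<close>

lemma lr_BA: "b \<in> B \<Longrightarrow> b \<in> lpart S z \<Longrightarrow> a \<in> A \<Longrightarrow> a \<in> rpart S z \<Longrightarrow> \<not> nonadj E b a"
  using lpart_B lpart_A unfolding rpart_def by auto

text \<open>This is where the pivot property enters: \<open>a\<close> and the pivot have a common
  non-neighbour in \<open>B\<close>, so they cannot both be adjacent to \<open>b\<close>, and the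
  pivot is.\<close>

lemma lr_AB: "a \<in> A \<Longrightarrow> a \<in> lpart S z \<Longrightarrow> b \<in> B \<Longrightarrow> b \<in> rpart S z \<Longrightarrow> nonadj E b a"
  using lpart_B lpart_A pivot unfolding rpart_def pivot_def by auto

text \<open>No difference loses elements. In the left part \<open>b\<close> itself witnesses that
  its non-neighbours in \<open>A\<close> are left, and the pivot is no element of the difference
  because \<open>c\<close> misses it too. In the right part a left vertex of \<open>A\<close> would
  be a non-neighbour of \<open>c\<close> by \<open>lr_AB\<close>.\<close>

lemma one_Sperner_parts:
  assumes "one_Sperner S"
  shows "one_Sperner (lpart S z)" "one_Sperner (rpart S z)"
proof -
  have "diffN (lpart S z) b c = diffN S b c"
    if "b \<in> B" "c \<in> B" "b \<in> lpart S z" "c \<in> lpart S z" for b c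
  proof -
    have "a \<in> lpart S z" if "a \<in> diffN S b c" for a
      using that \<open>b \<in> B\<close> \<open>b \<in> lpart S z\<close> \<open>c \<in> B\<close> \<open>c \<in> lpart S z\<close>
      by (auto simp: diffN_def lpart_A lpart_B)
    then show ?thesis using parts by (auto simp: diffN_def)
  qed
  then show "one_Sperner (lpart S z)"
    using one_Sperner_subset assms parts by blast
  have "diffN (rpart S z) b c = diffN S b c"
    if "b \<in> B" "c \<in> B" "b \<in> rpart S z" "c \<in> rpart S z" for b c
  proof -
    have "a \<in> rpart S z" if "a \<in> diffN S b c" for a
      using that \<open>b \<in> B\<close> \<open>b \<in> rpart S z\<close> \<open>c \<in> B\<close> \<open>c \<in> rpart S z\<close> lr_AB[of a c]
      by (auto simp: diffN_def rpart_def lpart_B)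
    then show ?thesis using parts by (auto simp: diffN_def)
  qed
  then show "one_Sperner (rpart S z)"
    using one_Sperner_subset assms parts by blast
qed

end

text \<open>The state just before the joins of \<open>glue\<close>: the pivot and both parts side by
  side, with no edges between them.\<close>

definition pre_realizes :: "'a set \<Rightarrow> 'a set \<Rightarrow> 'a \<Rightarrow> 'a cw_expr \<Rightarrow> bool" where
  "pre_realizes L R z e \<longleftrightarrow> k_expression 5 e \<and> verts (cw_graph e) = insert z (L \<union> R) \<and>
     edges (cw_graph e) = {d \<in> E. d \<subseteq> L \<or> d \<subseteq> R} \<and>
     (\<forall>v \<in> insert z (L \<union> R). label (cw_graph e) v =
        (if v = z then 5 else if v \<in> L then lab v + 2 else lab v))"

text \<open>No expression produces the graph without vertices, so an empty part has to be left out;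
  hence three shapes. Both parts are empty only for a single vertex, which needs no gluing.\<close>

lemma pre_realizes:
  assumes z: "z \<notin> L" "z \<notin> R"
  shows "realizes R e \<Longrightarrow> pre_realizes {} R z (Disjoint_Union (Create 5 z) e)"
    and "realizes L d \<Longrightarrow> pre_realizes L {} z (Disjoint_Union (Create 5 z) (shift_lab d))"
    and "L \<inter> R = {} \<Longrightarrow> realizes L d \<Longrightarrow> realizes R e \<Longrightarrow>
      pre_realizes L R z (Disjoint_Union (Create 5 z) (Disjoint_Union (shift_lab d) e))"
  using z edge
  by (auto simp: pre_realizes_def realizes_def shift_lab_def Let_def lab_def)

lemma realizes_glue:
  assumes "S \<subseteq> A \<union> B" "pivot S z" "pre_realizes (lpart S z) (rpart S z) z e"
  shows "realizes S (glue e)"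
proof -
  let ?L = "lpart S z" and ?R = "rpart S z" and ?G = "cw_graph e"
  define J where "J i j = {{u, v} | u v. u \<in> S \<and> v \<in> S \<and> label ?G u = i \<and> label ?G v = j}" for i j
  have S: "insert z (?L \<union> ?R) = S" using parts[OF assms(1,2)] by auto
  have v: "verts ?G = S" and k: "k_expression 5 e"
    and l: "\<And>v. v \<in> S \<Longrightarrow> label ?G v = (if v = z then 5 else if v \<in> ?L then lab v + 2 else lab v)"
    and ed: "edges ?G = {d \<in> E. d \<subseteq> ?L \<or> d \<subseteq> ?R}"
    using assms(3) unfolding pre_realizes_def S by auto
  have edg: "edges (cw_graph (glue e)) =
     edges ?G \<union> J 2 5 \<union> J 3 5 \<union> J 1 5 \<union> J 1 4 \<union> J 2 4 \<union> J 1 3"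
    by (simp add: glue_def Let_def J_def v)
  have J: "{u, w} \<in> J i j \<longleftrightarrow> u \<in> S \<and> w \<in> S \<and>
      (label ?G u = i \<and> label ?G w = j \<or> label ?G u = j \<and> label ?G w = i)" for u w i j
    unfolding J_def by (auto simp: doubleton_eq_iff)
  have pair: "{u, w} \<in> edges (cw_graph (glue e)) \<longleftrightarrow> {u, w} \<in> E \<and> u \<in> S \<and> w \<in> S"
    if "u \<noteq> w" for u w
  proof (cases "u \<in> S \<and> w \<in> S")
    case True
    have E: "{u, w} \<in> E \<longleftrightarrow> \<not> nonadj E u w" using that by (simp add: nonadj_def)
    \<comment> \<open>Five classes told apart by their labels; the adjacency check below runs
      through all pairs of them.\<close>
    have cls: "v = z \<and> label ?G v = 5 \<or>
        v \<in> A \<and> v \<in> ?L \<and> v \<notin> ?R \<and> v \<noteq> z \<and> label ?G v = 3 \<or>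
        v \<in> A \<and> v \<in> ?R \<and> v \<notin> ?L \<and> v \<noteq> z \<and> label ?G v = 1 \<or>
        v \<in> B \<and> v \<in> ?L \<and> v \<notin> ?R \<and> v \<noteq> z \<and> label ?G v = 4 \<or>
        v \<in> B \<and> v \<in> ?R \<and> v \<notin> ?L \<and> v \<noteq> z \<and> label ?G v = 2" if "v \<in> S" for v
    proof -
      have "v \<in> A \<and> v \<notin> B \<or> v \<in> B \<and> v \<notin> A" using that assms(1) disj by auto
      moreover have "v = z \<or> v \<in> ?L \<and> v \<notin> ?R \<and> v \<noteq> z \<or> v \<in> ?R \<and> v \<notin> ?L \<and> v \<noteq> z"
        using that parts[OF assms(1,2)] by blast
      ultimately show ?thesis using l[OF that] by (elim disjE) (simp_all add: lab_def)
    qed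
    have z: "v \<in> A \<Longrightarrow> \<not> nonadj E z v" "v \<in> B \<Longrightarrow> v \<in> ?L \<Longrightarrow> nonadj E z v"
      "v \<in> B \<Longrightarrow> v \<in> ?R \<Longrightarrow> \<not> nonadj E z v" for v
      using cliqueA z_in[OF assms(1,2)] lpart_B[OF assms(1,2)]
      by (auto simp: rpart_def nonadj_sym)
    note rel = z cliqueA cliqueB lr_BA[OF assms(1,2)] lr_AB[OF assms(1,2)]
    note rel' = z(2)[THEN nonadj_swap(1)] z(1,3)[THEN nonadj_swap(2)]
      lr_BA[OF assms(1,2), THEN nonadj_swap(2)] lr_AB[OF assms(1,2), THEN nonadj_swap(1)]
    have "label ?G z = 5" using l z_in[OF assms(1,2)] by simp
    then have "{u, w} \<in> edges (cw_graph (glue e)) \<longleftrightarrow> \<not> nonadj E u w"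
      unfolding edg ed Un_iff J mem_Collect_eq E insert_subset
      by (insert cls[OF conjunct1[OF True]] cls[OF conjunct2[OF True]] True that, elim disjE)
        (simp_all add: rel rel')
    then show ?thesis using True E by simp
  next
    case False
    then show ?thesis using S by (auto simp: edg ed J)
  qed
  have "edges (cw_graph (glue e)) = {d \<in> E. d \<subseteq> S}"
  proof (intro set_eqI iffI)
    fix d assume d: "d \<in> edges (cw_graph (glue e))"
    \<comment> \<open>Joined endpoints carry different labels, so a join adds no loops.\<close>
    have J_pair: "\<exists>u w. u \<noteq> w \<and> d = {u, w}" if "d \<in> J i j" "i \<noteq> j" for i j
    proof -
      from that obtain u w where "d = {u, w}" "label ?G u = i" "label ?G w = j"
        by (auto simp: J_def)
      then show ?thesis using \<open>i \<noteq> j\<close> by (intro exI[of _ u] exI[of _ w]) auto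
    qed
    from d have "\<exists>u w. u \<noteq> w \<and> d = {u, w}"
      unfolding edg ed Un_iff mem_Collect_eq
      by (elim disjE conjE) (erule J_pair, simp | erule edge)+
    with d show "d \<in> {d \<in> E. d \<subseteq> S}" using pair by auto
  next
    fix d assume d: "d \<in> {d \<in> E. d \<subseteq> S}"
    then have "\<exists>u w. u \<noteq> w \<and> d = {u, w}" by (auto dest: edge)
    with d show "d \<in> edges (cw_graph (glue e))" using pair by auto
  qed
  moreover have "label (cw_graph (glue e)) u = lab u" if "u \<in> S" for u
    using l[OF that] z_in[OF assms(1,2)] by (auto simp: glue_def Let_def lab_def)
  ultimately show ?thesis
    using k v by (simp add: realizes_def) (simp add: glue_def Let_def)
qed

lemma realizes_Create: "realizes {z} (Create (lab z) z)"
  using edge by (fastforce simp: realizes_def lab_def)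

text \<open>A part with several vertices meets \<open>A\<close> by \<open>one_Sperner_no_A\<close>
  and so has a pivot; one of its two subparts is then nonempty, as \<open>pre_realizes\<close>
  requires.\<close>

lemma realizable:
  assumes "finite S" "S \<noteq> {}" "S \<subseteq> A \<union> B" "one_Sperner S"
  shows "\<exists>e. realizes S e"
  using assms
proof (induction S rule: finite_psubset_induct)
  case (psubset S)
  show ?case
  proof (cases "\<exists>z. S = {z}")
    case True
    then show ?thesis using realizes_Create by blast
  next
    case False
    then have "A \<inter> S \<noteq> {}"
      using psubset one_Sperner_no_A by (metis ex_in_conv)
    then obtain z where z: "pivot S z" using pivot_exists psubset by blast
    note p = parts[OF psubset(4) z]
    have IH: "\<exists>e. realizes T e" if "T = lpart S z \<or> T = rpart S z" "T \<noteq> {}" for T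
      by (rule psubset.IH) (use that p z_in[OF psubset(4) z] psubset(4,5)
          one_Sperner_parts[OF psubset(4) z psubset(5)] in auto)
    have "\<exists>e. pre_realizes (lpart S z) (rpart S z) z e"
      using IH[of "lpart S z"] IH[of "rpart S z"] pre_realizes[OF p(2,3)] p(1,4) False
      by (cases "lpart S z = {}"; cases "rpart S z = {}") (simp_all, blast+)
    then show ?thesis using realizes_glue[OF psubset(4) z] by blast
  qed
qed

end

section \<open>Programs with counting loops\<close>

text \<open>Every loop runs for \<open>n\<close> rounds.  Hence these programs always halt, and the exponent of their
  running time is the nesting depth of the loops.\<close>

datatype fprog =
    FSkip
  | FWrite string rexp rexp
  | FSeq fprog fprog
  | FCond rexp fprog fprog
  | FFor string fprog

abbreviation Var :: "string \<Rightarrow> rexp" where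
  "Var x \<equiv> Read x (Const 0)"

abbreviation At :: "string \<Rightarrow> string \<Rightarrow> rexp" where
  "At a x \<equiv> Read a (Var x)"

fun compile :: "fprog \<Rightarrow> prog" where
  "compile FSkip = Skip"
| "compile (FWrite x a b) = Write x a b"
| "compile (FSeq p q) = Seq (compile p) (compile q)"
| "compile (FCond b p q) = Cond b (compile p) (compile q)"
| "compile (FFor x p) = Seq (Write x (Const 0) (Const 0))
     (Loop (Less (Var x) (Var ''n''))
       (Seq (compile p) (Write x (Const 0) (Add (Var x) (Const 1)))))"

fun writes :: "fprog \<Rightarrow> string set" where
  "writes FSkip = {}"
| "writes (FWrite x a b) = {x}"
| "writes (FSeq p q) = writes p \<union> writes q"
| "writes (FCond b p q) = writes p \<union> writes q"
| "writes (FFor x p) = insert x (writes p)"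

text \<open>The bound \<open>n\<close> is never changed and no loop body touches its counter, so
  every loop makes exactly \<open>n\<close> rounds.\<close>

fun wf_fprog :: "fprog \<Rightarrow> bool" where
  "wf_fprog FSkip \<longleftrightarrow> True"
| "wf_fprog (FWrite x a b) \<longleftrightarrow> x \<noteq> ''n''"
| "wf_fprog (FSeq p q) \<longleftrightarrow> wf_fprog p \<and> wf_fprog q"
| "wf_fprog (FCond b p q) \<longleftrightarrow> wf_fprog p \<and> wf_fprog q"
| "wf_fprog (FFor x p) \<longleftrightarrow> x \<noteq> ''n'' \<and> x \<notin> writes p \<and> wf_fprog p"

text \<open>The outer update of a loop records the value \<open>n\<close> at which the counter fails
  the test.\<close>

fun fexec :: "fprog \<Rightarrow> store \<Rightarrow> store" where
  "fexec FSkip s = s"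
| "fexec (FWrite x a b) s = store_upd s x (rval a s) (rval b s)"
| "fexec (FSeq p q) s = fexec q (fexec p s)"
| "fexec (FCond b p q) s = (if rval b s \<noteq> 0 then fexec p s else fexec q s)"
| "fexec (FFor x p) s = store_upd
     (fold (\<lambda>k s. fexec p (store_upd s x 0 k)) [0..<s ''n'' 0] s) x 0 (s ''n'' 0)"

text \<open>An upper bound, since a conditional is charged for both branches. In a loop,
  initialization costs 3 and each test 6, giving 9 with the last test; a round adds a test and an
  increment of cost 6 each to its body.\<close>

fun fcost :: "fprog \<Rightarrow> nat \<Rightarrow> nat" where
  "fcost FSkip n = 1"
| "fcost (FWrite x a b) n = 1 + rcost a + rcost b"
| "fcost (FSeq p q) n = fcost p n + fcost q n"
| "fcost (FCond b p q) n = 1 + rcost b + fcost p n + fcost q n"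
| "fcost (FFor x p) n = 9 + n * (12 + fcost p n)"

fun fdepth :: "fprog \<Rightarrow> nat" where
  "fdepth FSkip = 0"
| "fdepth (FWrite x a b) = 0"
| "fdepth (FSeq p q) = max (fdepth p) (fdepth q)"
| "fdepth (FCond b p q) = max (fdepth p) (fdepth q)"
| "fdepth (FFor x p) = Suc (fdepth p)"

declare fexec.simps(5) [simp del]

lemma store_upd_apply: "store_upd s x i v y = (if y = x then (s x)(i := v) else s y)"
  by (simp add: store_upd_def)

lemma store_upd_same [simp]: "store_upd s x i v x = (s x)(i := v)"
  and store_upd_other [simp]: "y \<noteq> x \<Longrightarrow> store_upd s x i v y = s y"
  by (simp_all add: store_upd_def)

lemma store_upd_twice: "store_upd (store_upd s x i v) x i w = store_upd s x i w"
  by (simp add: store_upd_def)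

lemma wf_fprog_n: "wf_fprog p \<Longrightarrow> ''n'' \<notin> writes p"
  by (induction p) auto

lemma fexec_frame [simp]: "y \<notin> writes p \<Longrightarrow> fexec p s y = s y"
proof (induction p arbitrary: s)
  case (FFor x p)
  have "fold (\<lambda>k s. fexec p (store_upd s x 0 k)) ks s y = s y" for ks
    using FFor by (induction ks arbitrary: s) auto
  then show ?case using FFor by (simp add: fexec.simps)
qed auto

lemma run_compile:
  assumes "wf_fprog p" "s ''n'' 0 = N"
  shows "\<exists>t \<le> fcost p N. run (compile p) s t (fexec p s)"
  using assms
proof (induction p arbitrary: s)
  case FSkip
  then show ?case using run_Skip[of s] by auto
next
  case (FWrite x a b)
  then show ?case using run_Write[of x a b s] by (intro exI[of _ "1 + rcost a + rcost b"]) simp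
next
  case (FSeq p q)
  from FSeq obtain t where t: "t \<le> fcost p N" "run (compile p) s t (fexec p s)" by auto
  have "fexec p s ''n'' 0 = N" using FSeq.prems wf_fprog_n by simp
  with FSeq obtain u where u: "u \<le> fcost q N" "run (compile q) (fexec p s) u (fexec q (fexec p s))"
    by fastforce
  show ?case using run_Seq[OF t(2) u(2)] t u by (auto intro!: exI[of _ "t + u"])
next
  case (FCond b p q)
  show ?case
  proof (cases "rval b s = 0")
    case True
    with FCond obtain t where t: "t \<le> fcost q N" "run (compile q) s t (fexec q s)" by auto
    show ?thesis using run_Cond_False[OF True t(2), of "compile p"] t True
      by (auto intro!: exI[of _ "1 + rcost b + t"])
  next
    case False
    with FCond obtain t where t: "t \<le> fcost p N" "run (compile p) s t (fexec p s)" by auto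
    show ?thesis using run_Cond_True[OF False t(2), of "compile q"] t False
      by (auto intro!: exI[of _ "1 + rcost b + t"])
  qed
next
  case (FFor x p)
  let ?b = "Less (Var x) (Var ''n'')"
  let ?body = "Seq (compile p) (Write x (Const 0) (Add (Var x) (Const 1)))"
  let ?f = "\<lambda>k s. fexec p (store_upd s x 0 k)"
  have wf: "x \<noteq> ''n''" "x \<notin> writes p" "wf_fprog p" "''n'' \<notin> writes p"
    using FFor.prems wf_fprog_n by auto
  \<comment> \<open>Induction on the number \<open>d\<close> of remaining rounds; the 6 pays for the
    final failing test.\<close>
  have "\<exists>t. t \<le> 6 + d * (12 + fcost p N) \<and>
      run (Loop ?b ?body) (store_upd s x 0 (N - d)) t (store_upd (fold ?f [N - d..<N] s) x 0 N)"
    if "d \<le> N" "s ''n'' 0 = N" for d s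
    using that
  proof (induction d arbitrary: s)
    case 0
    then have "rval ?b (store_upd s x 0 N) = 0" using wf by auto
    from run_Loop_False[OF this, of ?body] show ?case
      by (intro exI[of _ "1 + rcost ?b"]) simp
  next
    case (Suc d)
    define k where "k = N - Suc d"
    have k: "k < N" "Suc k = N - d" using Suc.prems by (auto simp: k_def)
    define s1 where "s1 = store_upd s x 0 k"
    have b: "rval ?b s1 \<noteq> 0" using k Suc.prems wf by (auto simp: s1_def)
    have "s1 ''n'' 0 = N" using Suc.prems wf by (simp add: s1_def)
    with FFor.IH[OF wf(3)] obtain t where t: "t \<le> fcost p N" "run (compile p) s1 t (fexec p s1)"
      by blast
    have "rval (Add (Var x) (Const 1)) (fexec p s1) = N - d"
      using wf k by (simp add: s1_def)
    then have w: "run (Write x (Const 0) (Add (Var x) (Const 1))) (fexec p s1) 6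
        (store_upd (fexec p s1) x 0 (N - d))"
      using run_Write[of x "Const 0" "Add (Var x) (Const 1)" "fexec p s1"]
      by (simp add: eval_nat_numeral)
    have "fexec p s1 ''n'' 0 = N" using Suc.prems wf by (simp add: s1_def)
    with Suc.IH[of "fexec p s1"] Suc.prems obtain u where u: "u \<le> 6 + d * (12 + fcost p N)"
      "run (Loop ?b ?body) (store_upd (fexec p s1) x 0 (N - d)) u
         (store_upd (fold ?f [N - d..<N] (fexec p s1)) x 0 N)" by auto
    have "fold ?f [N - Suc d..<N] s = fold ?f [N - d..<N] (fexec p s1)"
      using k upt_conv_Cons[of k N] by (simp add: k_def[symmetric] s1_def)
    with run_Loop_True[OF b run_Seq[OF t(2) w] u(2)] t u show ?case
      by (intro exI[of _ "1 + rcost ?b + (t + 6) + u"]) (simp add: k_def s1_def)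
  qed
  from this[of N s] FFor.prems obtain t where t: "t \<le> 6 + N * (12 + fcost p N)"
    "run (Loop ?b ?body) (store_upd s x 0 0) t (fexec (FFor x p) s)"
    by (auto simp: fexec.simps)
  have "run (Write x (Const 0) (Const 0)) s 3 (store_upd s x 0 0)"
    using run_Write[of x "Const 0" "Const 0" s] by (simp add: eval_nat_numeral)
  from run_Seq[OF this t(2)] t(1) show ?case
    by (intro exI[of _ "3 + t"]) simp
qed

lemma fcost_bigo: "(\<lambda>n. real (fcost p n)) \<in> O(\<lambda>n. real n ^ fdepth p)"
proof (induction p)
  have mono: "f \<in> O(\<lambda>n. real n ^ b)" if "f \<in> O(\<lambda>n. real n ^ a)" "a \<le> b" for f :: "nat \<Rightarrow> real" and a b
  proof (rule landau_o.big.trans[OF that(1) bigoI[of _ 1]])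
    show "\<forall>\<^sub>F n in sequentially. norm (real n ^ a) \<le> 1 * norm (real n ^ b)"
      using eventually_ge_at_top[of 1] by eventually_elim (use that(2) in \<open>simp add: power_increasing\<close>)
  qed
  have const: "(\<lambda>n. c) \<in> O(\<lambda>n. real n ^ b)" for c :: real and b
    by (rule mono[of _ 0]) simp_all
  {
    case (FSeq p q)
    have "(\<lambda>n. real (fcost p n) + real (fcost q n)) \<in> O(\<lambda>n. real n ^ max (fdepth p) (fdepth q))"
      by (intro sum_in_bigo(1) mono[OF FSeq(1)] mono[OF FSeq(2)]) simp_all
    then show ?case by simp
  next
    case (FCond b p q)
    have "(\<lambda>n. real (1 + rcost b) + real (fcost p n) + real (fcost q n))
        \<in> O(\<lambda>n. real n ^ max (fdepth p) (fdepth q))"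
      by (intro sum_in_bigo(1) const mono[OF FCond(1)] mono[OF FCond(2)]) simp_all
    then show ?case by (simp add: add.assoc)
  next
    case (FFor x p)
    have 1: "(\<lambda>n. 12 + real (fcost p n)) \<in> O(\<lambda>n. real n ^ fdepth p)"
      by (intro sum_in_bigo(1) const FFor)
    have 2: "(\<lambda>n. real n) \<in> O(\<lambda>n. real n)" by simp
    have "(\<lambda>n. real n * (12 + real (fcost p n))) \<in> O(\<lambda>n. real n ^ Suc (fdepth p))"
      using landau_o.big.mult[OF 2 1] by (simp only: power_Suc)
    from sum_in_bigo(1)[OF const[of 9] this] show ?case by simp
  next
    case FSkip
    show ?case by simp
  next
    case (FWrite x a b)
    show ?case using const[of "real (1 + rcost a + rcost b)" 0] by simp
  }
qed

text \<open>The invariant rule: \<open>I k\<close> describes the store before round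
  \<open>k\<close>. Leaving the loop sets the counter once more, which \<open>I N\<close> has to
  survive.\<close>

lemma fexec_FFor:
  assumes "I 0 s" "s ''n'' 0 = N"
    and "\<And>k s. k < N \<Longrightarrow> I k s \<Longrightarrow> I (Suc k) (fexec p (store_upd s x 0 k))"
    and "\<And>s. I N s \<Longrightarrow> I N (store_upd s x 0 N)"
  shows "I N (fexec (FFor x p) s)"
proof -
  have "I k (fold (\<lambda>k s. fexec p (store_upd s x 0 k)) [0..<k] s)" if "k \<le> N" for k
    using that
  proof (induction k)
    case (Suc k)
    then show ?case using assms(3)[OF _ Suc.IH] by simp
  qed (simp, rule assms(1))
  from assms(4)[OF this[OF order_refl]] show ?thesis unfolding fexec.simps assms(2) .
qed

section \<open>Boolean tests and linear searches\<close>

fun reads :: "rexp \<Rightarrow> string set" where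
  "reads (Const c) = {}"
| "reads (Read x a) = insert x (reads a)"
| "reads (Add a b) = reads a \<union> reads b"
| "reads (Sub a b) = reads a \<union> reads b"
| "reads (Less a b) = reads a \<union> reads b"
| "reads (Equal a b) = reads a \<union> reads b"

lemma rval_cong: "(\<And>x. x \<in> reads a \<Longrightarrow> s x = s' x) \<Longrightarrow> rval a s = rval a s'"
  by (induction a) auto

definition Not :: "rexp \<Rightarrow> rexp" where
  "Not a = Equal a (Const 0)"

definition And :: "rexp \<Rightarrow> rexp \<Rightarrow> rexp" where
  "And a b = Not (Add (Not a) (Not b))"

definition Or :: "rexp \<Rightarrow> rexp \<Rightarrow> rexp" where
  "Or a b = Not (Not (Add a b))"

lemma rval_bool [simp]:
  "rval (Not a) s = of_bool (rval a s = 0)"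
  "rval (And a b) s = of_bool (rval a s \<noteq> 0 \<and> rval b s \<noteq> 0)"
  "rval (Or a b) s = of_bool (rval a s \<noteq> 0 \<or> rval b s \<noteq> 0)"
  by (simp_all add: Not_def And_def Or_def)

lemma reads_bool [simp]:
  "reads (Not a) = reads a" "reads (And a b) = reads a \<union> reads b" "reads (Or a b) = reads a \<union> reads b"
  by (simp_all add: Not_def And_def Or_def)

definition Any :: "string \<Rightarrow> string \<Rightarrow> rexp \<Rightarrow> fprog" where
  "Any t x c = FSeq (FWrite t (Const 0) (Const 0)) (FFor x (FCond c (FWrite t (Const 0) (Const 1)) FSkip))"

text \<open>If the search fails, \<open>t\<close> keeps its old value; callers rely on this to
  supply a default.\<close>

definition Sel :: "string \<Rightarrow> string \<Rightarrow> rexp \<Rightarrow> fprog" where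
  "Sel t x c = FFor x (FCond c (FWrite t (Const 0) (Var x)) FSkip)"

lemma macro_simps [simp]:
  "writes (Any t x c) = {t, x}" "writes (Sel t x c) = {t, x}"
  "wf_fprog (Any t x c) \<longleftrightarrow> t \<noteq> ''n'' \<and> x \<noteq> ''n'' \<and> x \<noteq> t"
  "wf_fprog (Sel t x c) \<longleftrightarrow> t \<noteq> ''n'' \<and> x \<noteq> ''n'' \<and> x \<noteq> t"
  "fdepth (Any t x c) = 1" "fdepth (Sel t x c) = 1"
  by (auto simp: Any_def Sel_def)

lemma fexec_Any:
  assumes t: "t \<noteq> x" "t \<noteq> ''n''" "t \<notin> reads c" and x: "x \<noteq> ''n''"
  shows "fexec (Any t x c) s t 0 = of_bool (\<exists>k < s ''n'' 0. rval c (store_upd s x 0 k) \<noteq> 0)"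
proof -
  define s0 where "s0 = store_upd s t 0 0"
  define P where "P k \<longleftrightarrow> rval c (store_upd s x 0 k) \<noteq> 0" for k
  \<comment> \<open>The counter differs from round to round, so stores are compared only after
    overwriting it with equal values.\<close>
  define I where "I k s' \<longleftrightarrow> s' t 0 = of_bool (\<exists>j < k. P j) \<and>
    (\<forall>i y. y \<noteq> t \<longrightarrow> store_upd s' x 0 i y = store_upd s x 0 i y)" for k s'
  have "I (s ''n'' 0) (fexec (FFor x (FCond c (FWrite t (Const 0) (Const 1)) FSkip)) s0)"
  proof (rule fexec_FFor[where I = I])
    fix k s' assume I: "I k s'"
    have "rval c (store_upd s' x 0 k) = rval c (store_upd s x 0 k)"
      by (rule rval_cong) (use I t in \<open>auto simp: I_def\<close>)
    then have "rval c (store_upd s' x 0 k) \<noteq> 0 \<longleftrightarrow> P k" by (simp add: P_def)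
    moreover have "store_upd (fexec (FCond c (FWrite t (Const 0) (Const 1)) FSkip) (store_upd s' x 0 k)) x 0 i y =
        store_upd s' x 0 i y" if "y \<noteq> t" for i y
      using that by (cases "y = x") auto
    ultimately show "I (Suc k) (fexec (FCond c (FWrite t (Const 0) (Const 1)) FSkip) (store_upd s' x 0 k))"
      using I t by (auto simp: I_def less_Suc_eq)
  qed (use t x in \<open>auto simp: I_def s0_def store_upd_twice store_upd_apply\<close>)
  then show ?thesis by (simp add: Any_def s0_def I_def P_def)
qed

lemma fexec_Sel:
  assumes t: "t \<noteq> x" "t \<noteq> ''n''" "t \<notin> reads c" and x: "x \<noteq> ''n''"
    and v: "v = fexec (Sel t x c) s t 0"
  shows "(v < s ''n'' 0 \<and> rval c (store_upd s x 0 v) \<noteq> 0) \<or>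
     (v = s t 0 \<and> (\<forall>k < s ''n'' 0. rval c (store_upd s x 0 k) = 0))"
proof -
  define P where "P k \<longleftrightarrow> rval c (store_upd s x 0 k) \<noteq> 0" for k
  define I where "I k s' \<longleftrightarrow> ((s' t 0 < k \<and> P (s' t 0)) \<or> (s' t 0 = s t 0 \<and> (\<forall>j < k. \<not> P j))) \<and>
    (\<forall>i y. y \<noteq> t \<longrightarrow> store_upd s' x 0 i y = store_upd s x 0 i y)" for k s'
  have "I (s ''n'' 0) (fexec (FFor x (FCond c (FWrite t (Const 0) (Var x)) FSkip)) s)"
  proof (rule fexec_FFor[where I = I])
    fix k s' assume I: "I k s'"
    have "rval c (store_upd s' x 0 k) = rval c (store_upd s x 0 k)"
      by (rule rval_cong) (use I t in \<open>auto simp: I_def\<close>)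
    then have "rval c (store_upd s' x 0 k) \<noteq> 0 \<longleftrightarrow> P k" by (simp add: P_def)
    moreover have "store_upd (fexec (FCond c (FWrite t (Const 0) (Var x)) FSkip) (store_upd s' x 0 k)) x 0 i y =
        store_upd s' x 0 i y" if "y \<noteq> t" for i y
      using that by (cases "y = x") auto
    ultimately show "I (Suc k) (fexec (FCond c (FWrite t (Const 0) (Var x)) FSkip) (store_upd s' x 0 k))"
      using I t by (auto simp: I_def less_Suc_eq)
  qed (use t x in \<open>auto simp: I_def store_upd_twice\<close>)
  then show ?thesis unfolding v by (simp add: Sel_def I_def P_def)
qed

section \<open>Writing the output\<close>

definition emit :: "rexp \<Rightarrow> fprog" where
  "emit a = FSeq (FWrite ''out'' (Var ''outlen'') a)
     (FWrite ''outlen'' (Const 0) (Add (Var ''outlen'') (Const 1)))"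

fun emits :: "rexp list \<Rightarrow> fprog" where
  "emits [] = FSkip"
| "emits (a # as) = FSeq (emit a) (emits as)"

text \<open>The analogue of \<open>output_is\<close> for arbitrary lists, because during the run the
  output is only the beginning of a code.\<close>

definition has_output :: "store \<Rightarrow> nat list \<Rightarrow> bool" where
  "has_output s xs \<longleftrightarrow> s ''outlen'' 0 = length xs \<and> (\<forall>i < length xs. s ''out'' i = xs ! i)"

lemma emits_simps [simp]:
  "writes (emit a) = {''out'', ''outlen''}" "wf_fprog (emit a)" "fdepth (emit a) = 0"
  by (auto simp: emit_def)

lemma writes_emits: "writes (emits as) \<subseteq> {''out'', ''outlen''}"
  by (induction as) auto

lemma frame_emits [simp]: "y \<noteq> ''out'' \<Longrightarrow> y \<noteq> ''outlen'' \<Longrightarrow> fexec (emits as) s y = s y"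
  using writes_emits[of as] by (intro fexec_frame) auto

lemma wf_emits [simp]: "wf_fprog (emits as)" "fdepth (emits as) = 0"
  by (induction as) auto

lemma output_emits:
  assumes "has_output s xs" "\<forall>a \<in> set as. ''out'' \<notin> reads a \<and> ''outlen'' \<notin> reads a"
  shows "has_output (fexec (emits as) s) (xs @ map (\<lambda>a. rval a s) as)"
  using assms
proof (induction as arbitrary: s xs)
  case (Cons a as)
  let ?s = "fexec (emit a) s"
  have "has_output ?s (xs @ [rval a s])"
    using Cons.prems(1) by (auto simp: has_output_def emit_def nth_append less_Suc_eq)
  moreover have "rval b ?s = rval b s" if "b \<in> set as" for b
    using that Cons.prems(2) by (intro rval_cong fexec_frame) auto
  then have eq: "map (\<lambda>a. rval a ?s) as = map (\<lambda>a. rval a s) as" by simp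
  ultimately have "has_output (fexec (emits as) ?s) ((xs @ [rval a s]) @ map (\<lambda>a. rval a ?s) as)"
    using Cons.prems(2) by (intro Cons.IH) auto
  then show ?case unfolding eq by simp
qed simp

section \<open>Finding the two cliques\<close>

definition proper :: "nat set set \<Rightarrow> nat \<Rightarrow> (nat \<Rightarrow> nat) \<Rightarrow> bool" where
  "proper E N c \<longleftrightarrow> (\<forall>u < N. c u = 1 \<or> c u = 2) \<and> (\<forall>u < N. \<forall>v < N. nonadj E u v \<longrightarrow> c u \<noteq> c v)"

text \<open>Colour 0 means uncoloured. As the invariant of the colouring it guarantees that no
  choice has to be taken back.\<close>

definition extendable :: "nat set set \<Rightarrow> nat \<Rightarrow> (nat \<Rightarrow> nat) \<Rightarrow> bool" where
  "extendable E N col \<longleftrightarrow> (\<exists>c. proper E N c \<and> (\<forall>u < N. col u \<noteq> 0 \<longrightarrow> col u = c u))"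

lemma extendable_forced:
  assumes "extendable E N col" "u < N" "v < N" "col v \<noteq> 0" "nonadj E u v"
  shows "extendable E N (col(u := if col v = 1 then 2 else 1))"
proof -
  obtain c where c: "proper E N c" "\<forall>u < N. col u \<noteq> 0 \<longrightarrow> col u = c u"
    using assms(1) unfolding extendable_def by blast
  have "c u \<noteq> c v" "c u = 1 \<or> c u = 2" "c v = 1 \<or> c v = 2" "col v = c v"
    using c assms unfolding proper_def by auto
  then have "c u = (if col v = 1 then 2 else 1)" by auto
  then show ?thesis using c unfolding extendable_def by (intro exI[of _ c]) auto
qed

text \<open>The uncoloured vertices form a union of components of the complement, where the two
  colours may be exchanged.\<close>

lemma extendable_free:
  assumes "extendable E N col" "u < N" "col u = 0"
    and "\<And>w v. w < N \<Longrightarrow> v < N \<Longrightarrow> col w = 0 \<Longrightarrow> col v \<noteq> 0 \<Longrightarrow> \<not> nonadj E w v"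
  shows "extendable E N (col(u := 1))"
proof -
  obtain c where c: "proper E N c" "\<forall>u < N. col u \<noteq> 0 \<longrightarrow> col u = c u"
    using assms(1) unfolding extendable_def by blast
  \<comment> \<open>\<open>3 - c w\<close> exchanges 1 and 2. All uncoloured vertices are exchanged
    together, and only if the chosen \<open>u\<close> has the wrong colour.\<close>
  define c' where "c' w = (if col w = 0 \<and> c u = 2 then 3 - c w else c w)" for w
  have 1: "c' w = 1 \<or> c' w = 2" if "w < N" for w
    using that c(1) by (auto simp: proper_def c'_def)
  have 2: "c' w \<noteq> c' v" if "w < N" "v < N" "nonadj E w v" for w v
  proof -
    have "col w = 0 \<longleftrightarrow> col v = 0"
      using assms(4) that nonadj_sym by metis
    moreover have "c w \<noteq> c v" "c w = 1 \<or> c w = 2" "c v = 1 \<or> c v = 2"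
      using c(1) that unfolding proper_def by auto
    ultimately show ?thesis by (auto simp: c'_def)
  qed
  have "c' u = 1" using c(1) assms unfolding proper_def c'_def by force
  then show ?thesis
    unfolding extendable_def using 1 2 c(2)
    by (intro exI[of _ c'] conjI) (auto simp: proper_def c'_def)
qed

text \<open>Without multiplication the offsets \<open>u * N\<close> of the matrix rows must be
  tabulated once, by repeated addition.\<close>

definition base :: "nat set set \<Rightarrow> nat \<Rightarrow> store \<Rightarrow> bool" where
  "base E N s \<longleftrightarrow> s ''n'' 0 = N \<and> (\<forall>u < N. s ''row'' u = u * N) \<and>
     (\<forall>u < N. \<forall>v < N. s ''adj'' (u * N + v) = of_bool ({u, v} \<in> E))"

lemma base_fexec [simp]:
  "''n'' \<notin> writes p \<Longrightarrow> ''row'' \<notin> writes p \<Longrightarrow> ''adj'' \<notin> writes p \<Longrightarrow>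
     base E N (fexec p s) \<longleftrightarrow> base E N s"
  by (simp add: base_def)

lemma base_upd [simp]:
  "y \<noteq> ''n'' \<Longrightarrow> y \<noteq> ''row'' \<Longrightarrow> y \<noteq> ''adj'' \<Longrightarrow> base E N (store_upd s y i v) \<longleftrightarrow> base E N s"
  by (simp add: base_def)

lemma base_n: "base E N s \<Longrightarrow> s ''n'' 0 = N"
  by (simp add: base_def)

definition NonE :: "string \<Rightarrow> string \<Rightarrow> rexp" where
  "NonE x y = Equal (Add (Equal (Var x) (Var y)) (Read ''adj'' (Add (At ''row'' x) (Var y)))) (Const 0)"

lemma rval_NonE [simp]:
  "base E N s \<Longrightarrow> s x 0 < N \<Longrightarrow> s y 0 < N \<Longrightarrow> rval (NonE x y) s = of_bool (nonadj E (s x 0) (s y 0))"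
  by (auto simp: NonE_def base_def nonadj_def)

lemma reads_NonE [simp]: "reads (NonE x y) = {x, y, ''row'', ''adj''}"
  by (auto simp: NonE_def)

definition init_rows :: fprog where
  "init_rows = FFor ''u'' (FWrite ''row'' (Add (Var ''u'') (Const 1)) (Add (At ''row'' ''u'') (Var ''n'')))"

lemma base_init_rows:
  assumes "simple_graph G" "verts G = {..<N}"
  shows "base (edges G) N (fexec init_rows (input_store G))"
proof -
  let ?s = "input_store G"
  let ?I = "\<lambda>k s. s ''n'' = ?s ''n'' \<and> (\<forall>u \<le> k. s ''row'' u = u * N)"
  have N: "?s ''n'' 0 = N" using assms by (simp add: input_store_def)
  have "?I N (fexec init_rows ?s)"
    unfolding init_rows_def
    by (rule fexec_FFor[where I = ?I]) (use N in \<open>auto simp: input_store_def le_Suc_eq\<close>)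
  moreover have "fexec init_rows ?s ''adj'' (u * N + v) = of_bool ({u, v} \<in> edges G)"
    if "u < N" "v < N" for u v
  proof -
    have "u * N + v < N * N"
    proof -
      have "u * N + v < Suc u * N" using that by simp
      also have "\<dots> \<le> N * N" using that by (intro mult_right_mono) auto
      finally show ?thesis .
    qed
    moreover have "(u * N + v) div N = u" "(u * N + v) mod N = v" using that by auto
    ultimately show ?thesis using assms by (simp add: init_rows_def input_store_def)
  qed
  ultimately show ?thesis using N by (simp add: base_def)
qed

section \<open>Vertices that are placed in the first clique\<close>

definition dominated :: "nat set set \<Rightarrow> nat \<Rightarrow> nat \<Rightarrow> bool" where
  "dominated E N u \<longleftrightarrow> (\<exists>v < N. v \<noteq> u \<and> (\<forall>w < N. nonadj E u w \<longrightarrow> nonadj E v w))"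

definition col_dominated :: fprog where
  "col_dominated = FFor ''u'' (FFor ''v'' (FSeq
     (Any ''t'' ''w'' (And (NonE ''u'' ''w'') (Not (NonE ''v'' ''w''))))
     (FCond (Or (Var ''t'') (Equal (Var ''u'') (Var ''v''))) FSkip (FWrite ''col'' (Var ''u'') (Const 1)))))"

lemma col_dominated:
  assumes "base E N s" "\<And>u. s ''col'' u = 0" "u < N"
  shows "fexec col_dominated s ''col'' u = of_bool (dominated E N u)"
proof -
  define P where "P u v \<longleftrightarrow> v \<noteq> u \<and> (\<forall>w < N. nonadj E u w \<longrightarrow> nonadj E v w)" for u v
  define I where "I k s \<longleftrightarrow> base E N s \<and> (\<forall>u. s ''col'' u = of_bool (u < k \<and> (\<exists>v < N. P u v)))" for k s
  define J where "J u k s \<longleftrightarrow> base E N s \<and> s ''u'' 0 = u \<and>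
    (\<forall>w. s ''col'' w = of_bool (w < u \<and> (\<exists>v < N. P w v) \<or> w = u \<and> (\<exists>v < k. P w v)))" for u k s
  have "I N (fexec col_dominated s)"
    unfolding col_dominated_def
  proof (rule fexec_FFor[where I = I])
    show "I 0 s" using assms by (simp add: I_def)
    show "s ''n'' 0 = N" using assms(1) by (rule base_n)
    show "I N (store_upd s ''u'' 0 N)" if "I N s" for s
      using that by (simp add: I_def)
    fix u s assume u: "u < N" and I: "I u s"
    let ?p = "FSeq (Any ''t'' ''w'' (And (NonE ''u'' ''w'') (Not (NonE ''v'' ''w''))))
     (FCond (Or (Var ''t'') (Equal (Var ''u'') (Var ''v''))) FSkip (FWrite ''col'' (Var ''u'') (Const 1)))"
    have "J u N (fexec (FFor ''v'' ?p) (store_upd s ''u'' 0 u))"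
    proof (rule fexec_FFor[where I = "J u"])
      show "J u 0 (store_upd s ''u'' 0 u)" using I by (simp add: I_def J_def)
      show "store_upd s ''u'' 0 u ''n'' 0 = N" using I by (auto simp: I_def dest: base_n)
      show "J u N (store_upd s ''v'' 0 N)" if "J u N s" for s
        using that by (simp add: J_def)
      fix v s assume v: "v < N" and J: "J u v s"
      let ?s = "store_upd s ''v'' 0 v"
      have b: "base E N ?s" using J by (simp add: J_def)
      have t: "fexec (Any ''t'' ''w'' (And (NonE ''u'' ''w'') (Not (NonE ''v'' ''w'')))) ?s ''t'' 0
         = of_bool (\<exists>w < N. nonadj E u w \<and> \<not> nonadj E v w)"
        using u v b base_n[OF b] J by (subst fexec_Any) (auto simp: J_def)
      show "J u (Suc v) (fexec ?p ?s)"
        using J t u v by (auto simp: J_def P_def less_Suc_eq)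
    qed
    then show "I (Suc u) (fexec (FFor ''v'' ?p) (store_upd s ''u'' 0 u))"
      using u by (auto simp: I_def J_def less_Suc_eq)
  qed
  then show ?thesis using assms(3) by (simp add: I_def P_def dominated_def)
qed

section \<open>Colouring the complement vertex by vertex\<close>

definition pick_boundary :: fprog where
  "pick_boundary = FFor ''u'' (FSeq
     (Any ''t'' ''v'' (And (At ''col'' ''v'') (And (Not (At ''col'' ''u'')) (NonE ''u'' ''v''))))
     (FCond (Var ''t'') (FWrite ''pick'' (Const 0) (Var ''u'')) FSkip))"

text \<open>Vertices whose colour is forced take precedence; the earlier value of
  \<open>pick\<close> survives only if there are none, and then a free choice is safe.\<close>

lemma pick_boundary:
  assumes "base E N s"
  defines "P \<equiv> \<lambda>u. s ''col'' u = 0 \<and> (\<exists>v < N. s ''col'' v \<noteq> 0 \<and> nonadj E u v)"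
    and "w \<equiv> fexec pick_boundary s ''pick'' 0"
  shows "(w < N \<and> P w) \<or> (w = s ''pick'' 0 \<and> (\<forall>u < N. \<not> P u))"
proof -
  define c where "c = s ''col''"
  define I where "I k s' \<longleftrightarrow> base E N s' \<and> s' ''col'' = c \<and>
     ((s' ''pick'' 0 < N \<and> P (s' ''pick'' 0)) \<or> (s' ''pick'' 0 = s ''pick'' 0 \<and> (\<forall>u < k. \<not> P u)))" for k s'
  have "I N (fexec pick_boundary s)"
    unfolding pick_boundary_def
  proof (rule fexec_FFor[where I = I])
    fix u s' assume u: "u < N" and I: "I u s'"
    let ?s = "store_upd s' ''u'' 0 u"
    have b: "base E N ?s" using I by (simp add: I_def)
    have "fexec (Any ''t'' ''v'' (And (At ''col'' ''v'') (And (Not (At ''col'' ''u'')) (NonE ''u'' ''v'')))) ?s ''t'' 0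
       = of_bool (P u)"
      using u b base_n[OF b] I by (subst fexec_Any) (auto simp: I_def P_def c_def)
    then show "I (Suc u) (fexec (FSeq (Any ''t'' ''v'' (And (At ''col'' ''v'') (And (Not (At ''col'' ''u'')) (NonE ''u'' ''v''))))
     (FCond (Var ''t'') (FWrite ''pick'' (Const 0) (Var ''u'')) FSkip)) ?s)"
      using I u by (auto simp: I_def less_Suc_eq)
  qed (use assms in \<open>auto simp: I_def c_def base_n\<close>)
  then show ?thesis by (simp add: I_def w_def)
qed

text \<open>Without a coloured non-neighbour, \<open>q\<close> is still the uncoloured vertex \<open>pick\<close> itself, whose
  entry 0 in \<open>col\<close> leads to colour 1.\<close>

definition colour_next :: fprog where
  "colour_next = FSeq (FWrite ''pick'' (Const 0) (Const 0))
    (FSeq (Sel ''pick'' ''u'' (Not (At ''col'' ''u'')))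
    (FSeq pick_boundary
    (FSeq (FWrite ''q'' (Const 0) (Var ''pick''))
    (FSeq (Sel ''q'' ''v'' (And (At ''col'' ''v'') (NonE ''pick'' ''v'')))
    (FCond (At ''col'' ''pick'') FSkip
      (FWrite ''col'' (Var ''pick'') (Add (Const 1) (Equal (At ''col'' ''q'') (Const 1)))))))))"

lemma pick_boundary_simps [simp]:
  "writes pick_boundary = {''u'', ''t'', ''v'', ''pick''}" "wf_fprog pick_boundary" "fdepth pick_boundary = 2"
  by (auto simp: pick_boundary_def)

lemma colour_next_simps [simp]:
  "writes colour_next = {''u'', ''t'', ''v'', ''pick'', ''q'', ''col''}" "wf_fprog colour_next" "fdepth colour_next = 2"
  by (auto simp: colour_next_def)

text \<open>The two ways of colouring a vertex are those of \<open>extendable_forced\<close> and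
  \<open>extendable_free\<close>, with their premises.\<close>

lemma colour_next:
  assumes b: "base E N s" and "0 < N"
  defines "c \<equiv> s ''col''" and "c' \<equiv> fexec colour_next s ''col''"
  shows "((\<forall>u < N. c u \<noteq> 0) \<and> c' = c) \<or>
    (\<exists>u < N. c u = 0 \<and>
      ((\<exists>v < N. c v \<noteq> 0 \<and> nonadj E u v \<and> c' = c(u := if c v = 1 then 2 else 1)) \<or>
       ((\<forall>w < N. \<forall>v < N. c w = 0 \<longrightarrow> c v \<noteq> 0 \<longrightarrow> \<not> nonadj E w v) \<and> c' = c(u := 1))))"
proof -
  define P where "P = (\<lambda>u. c u = 0 \<and> (\<exists>v < N. c v \<noteq> 0 \<and> nonadj E u v))"
  define s1 where "s1 = fexec (Sel ''pick'' ''u'' (Not (At ''col'' ''u''))) (store_upd s ''pick'' 0 0)"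
  define s2 where "s2 = fexec pick_boundary s1"
  define s3 where "s3 = store_upd s2 ''q'' 0 (s2 ''pick'' 0)"
  define s4 where "s4 = fexec (Sel ''q'' ''v'' (And (At ''col'' ''v'') (NonE ''pick'' ''v''))) s3"
  define w where "w = s2 ''pick'' 0"
  have b': "base E N s1" "base E N s2" "base E N s3"
    using b by (simp_all add: s1_def s2_def s3_def)
  have col: "s1 ''col'' = c" "s2 ''col'' = c" "s3 ''col'' = c" "s4 ''col'' = c"
    by (simp_all add: s1_def s2_def s3_def s4_def c_def)
  have pick: "s3 ''pick'' 0 = w" "s4 ''pick'' 0 = w"
    by (simp_all add: s3_def s4_def w_def)
  have 1: "(s1 ''pick'' 0 < N \<and> c (s1 ''pick'' 0) = 0) \<or> (s1 ''pick'' 0 = 0 \<and> (\<forall>u < N. c u \<noteq> 0))"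
    using fexec_Sel[of "''pick''" "''u''" "Not (At ''col'' ''u'')" _ "store_upd s ''pick'' 0 0"] base_n[OF b]
    by (auto simp: s1_def c_def)
  have 2: "(w < N \<and> P w) \<or> (w = s1 ''pick'' 0 \<and> (\<forall>u < N. \<not> P u))"
    using pick_boundary[OF b'(1)] unfolding s2_def[symmetric] w_def[symmetric] col P_def .
  have w: "w < N" using 1 2 \<open>0 < N\<close> by auto
  have c': "c' = (if c w = 0 then c(w := 1 + of_bool (c (s4 ''q'' 0) = 1)) else c)"
    unfolding c'_def colour_next_def
    by (simp add: s1_def[symmetric] s2_def[symmetric] s3_def[symmetric] s4_def[symmetric] col
        flip: pick(2))
  have 3: "(s4 ''q'' 0 < N \<and> c (s4 ''q'' 0) \<noteq> 0 \<and> nonadj E w (s4 ''q'' 0)) \<or>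
      (s4 ''q'' 0 = w \<and> (\<forall>v < N. c v \<noteq> 0 \<longrightarrow> \<not> nonadj E w v))"
    using fexec_Sel[of "''q''" "''v''" "And (At ''col'' ''v'') (NonE ''pick'' ''v'')" "s4 ''q'' 0" s3]
      base_n[OF b'(3)] b'(3) w col pick
    unfolding s4_def[symmetric] by (auto simp: s3_def w_def)
  show ?thesis
  proof (cases "c w = 0")
    case False
    then have "\<forall>u < N. c u \<noteq> 0" using 1 2 by (auto simp: P_def)
    then show ?thesis using c' False by simp
  next
    case True
    from 3 show ?thesis
    proof
      assume *: "s4 ''q'' 0 < N \<and> c (s4 ''q'' 0) \<noteq> 0 \<and> nonadj E w (s4 ''q'' 0)"
      then show ?thesis using w True c'
        by (intro disjI2 exI[of _ w] conjI disjI1 exI[of _ "s4 ''q'' 0"]) auto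
    next
      assume *: "s4 ''q'' 0 = w \<and> (\<forall>v < N. c v \<noteq> 0 \<longrightarrow> \<not> nonadj E w v)"
      then have "\<not> P w" by (auto simp: P_def)
      then have "\<forall>u < N. \<forall>v < N. c u = 0 \<longrightarrow> c v \<noteq> 0 \<longrightarrow> \<not> nonadj E u v"
        using 2 unfolding P_def by blast
      then show ?thesis using w True c' *
        by (intro disjI2 exI[of _ w] conjI) auto
    qed
  qed
qed

definition colouring :: fprog where
  "colouring = FFor ''r'' colour_next"

text \<open>Each round colours a vertex as long as one is uncoloured, so \<open>N\<close> rounds
  complete the colouring without changing the prescribed part.\<close>

lemma colouring:
  assumes b: "base E N s" and "0 < N" and ext: "extendable E N (s ''col'')"
  defines "c \<equiv> fexec colouring s ''col''"
  shows "proper E N c \<and> (\<forall>u < N. s ''col'' u \<noteq> 0 \<longrightarrow> c u = s ''col'' u)"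
proof -
  define Z where "Z c = {u. u < N \<and> c u = (0 :: nat)}" for c
  have fin: "finite (Z c)" for c by (simp add: Z_def)
  define I where "I k s' \<longleftrightarrow> base E N s' \<and> extendable E N (s' ''col'') \<and> card (Z (s' ''col'')) \<le> N - k \<and>
    (\<forall>u < N. s ''col'' u \<noteq> 0 \<longrightarrow> s' ''col'' u = s ''col'' u)" for k s'
  have "I N (fexec colouring s)"
    unfolding colouring_def
  proof (rule fexec_FFor[where I = I])
    have "card (Z (s ''col'')) \<le> card {..<N}" by (rule card_mono) (auto simp: Z_def)
    then show "I 0 s" using assms by (simp add: I_def)
    show "s ''n'' 0 = N" using b by (rule base_n)
    show "I N (store_upd s ''r'' 0 N)" if "I N s" for s
      using that by (simp add: I_def)
    fix k s' assume k: "k < N" and I: "I k s'"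
    let ?s = "store_upd s' ''r'' 0 k"
    let ?c = "s' ''col''" and ?c' = "fexec colour_next ?s ''col''"
    have b': "base E N ?s" using I by (simp add: I_def)
    from colour_next[OF b' \<open>0 < N\<close>]
    have "extendable E N ?c' \<and> card (Z ?c') \<le> N - Suc k \<and> (\<forall>u < N. ?c u \<noteq> 0 \<longrightarrow> ?c' u = ?c u)"
    proof (elim disjE exE conjE)
      assume "\<forall>u<N. ?s ''col'' u \<noteq> 0" "?c' = ?s ''col''"
      moreover from this have "Z ?c' = {}" by (auto simp: Z_def)
      ultimately show ?thesis using I by (simp add: I_def)
    next
      fix u assume u: "u < N" "?s ''col'' u = 0"
      have *: "card (Z (?c(u := Suc d))) \<le> N - Suc k" for d
      proof -
        have "Z (?c(u := Suc d)) = Z ?c - {u}" "u \<in> Z ?c" using u by (auto simp: Z_def)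
        moreover have "card (Z ?c) \<le> N - k" using I by (simp add: I_def)
        ultimately show ?thesis by simp
      qed
      {
        fix v assume "v < N" "?s ''col'' v \<noteq> 0" "nonadj E u v"
          "?c' = (?s ''col'')(u := if ?s ''col'' v = 1 then 2 else 1)"
        then show ?thesis
          using u *[of 0] *[of 1] I extendable_forced[of E N ?c u v]
          by (auto simp: I_def numeral_2_eq_2)
      next
        assume "\<forall>w<N. \<forall>v<N. ?s ''col'' w = 0 \<longrightarrow> ?s ''col'' v \<noteq> 0 \<longrightarrow> \<not> nonadj E w v"
          "?c' = (?s ''col'')(u := 1)"
        then show ?thesis
          using u *[of 0] I extendable_free[of E N ?c u] by (auto simp: I_def)
      }
    qed
    then show "I (Suc k) (fexec colour_next ?s)"
      using I by (auto simp: I_def)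
  qed
  then have I: "extendable E N c" "card (Z c) = 0" "\<forall>u < N. s ''col'' u \<noteq> 0 \<longrightarrow> c u = s ''col'' u"
    by (simp_all add: I_def c_def)
  then have "\<forall>u < N. c u \<noteq> 0" using fin[of c] by (auto simp: Z_def)
  with I show ?thesis by (auto simp: extendable_def proper_def)
qed

section \<open>Decomposing the graph\<close>

lemma fexec_Any_iff:
  assumes "t \<noteq> x" "t \<noteq> ''n''" "t \<notin> reads c" "x \<noteq> ''n''" "s ''n'' 0 = N"
    and "\<And>k. k < N \<Longrightarrow> rval c (store_upd s x 0 k) \<noteq> 0 \<longleftrightarrow> P k"
  shows "fexec (Any t x c) s t 0 = of_bool (\<exists>k < N. P k)"
  using assms by (subst fexec_Any) auto

text \<open>\<open>lvl\<close> stores for each vertex the level of its part on the stack, with 0 for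
  vertices already output, and \<open>sp\<close> is the topmost level.\<close>

definition In_top :: "string \<Rightarrow> rexp" where
  "In_top x = Equal (At ''lvl'' x) (Var ''sp'')"

definition In_B :: "string \<Rightarrow> rexp" where
  "In_B x = And (In_top x) (Equal (At ''col'' x) (Const 2))"

lemma reads_In [simp]: "reads (In_top x) = {x, ''lvl'', ''sp''}" "reads (In_B x) = {x, ''lvl'', ''sp'', ''col''}"
  by (auto simp: In_top_def In_B_def)

definition is_pivot :: fprog where
  "is_pivot = FSeq (FWrite ''bad'' (Const 0) (Const 0))
     (FFor ''x'' (FCond (And (In_top ''x'') (And (Equal (At ''col'' ''x'') (Const 1)) (Not (Equal (Var ''x'') (Var ''y'')))))
       (FSeq (Any ''p'' ''b'' (And (In_B ''b'') (And (NonE ''b'' ''y'') (NonE ''b'' ''x''))))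
       (FSeq (Any ''q'' ''b'' (And (In_B ''b'') (And (Not (NonE ''b'' ''y'')) (Not (NonE ''b'' ''x'')))))
         (FCond (And (Var ''p'') (Var ''q'')) (FWrite ''bad'' (Const 0) (Const 1)) FSkip)))
       FSkip))"

definition find_pivot :: fprog where
  "find_pivot = FFor ''y'' (FCond (And (In_top ''y'') (Equal (At ''col'' ''y'') (Const 1)))
     (FSeq is_pivot (FCond (Var ''bad'') FSkip (FWrite ''z'' (Const 0) (Var ''y'')))) FSkip)"

text \<open>Entries of \<open>mark\<close> from earlier rounds do no harm: every entry that
  \<open>move_left\<close> consults is rewritten here.\<close>

definition mark_left :: fprog where
  "mark_left = FSeq (FWrite ''left'' (Const 0) (Const 0)) (FSeq (FWrite ''right'' (Const 0) (Const 0))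
     (FFor ''x'' (FCond (And (In_top ''x'') (Not (Equal (Var ''x'') (Var ''z''))))
       (FSeq (Any ''p'' ''b'' (And (In_B ''b'') (And (NonE ''b'' ''z'') (Or (NonE ''b'' ''x'') (Equal (Var ''b'') (Var ''x''))))))
       (FSeq (FWrite ''mark'' (Var ''x'') (Var ''p''))
         (FCond (Var ''p'') (FWrite ''left'' (Const 0) (Const 1)) (FWrite ''right'' (Const 0) (Const 1)))))
       FSkip)))"

text \<open>The right part stays on the top level and the left part goes on top of it; if the right part is
  empty, the left part takes its place, so that no level becomes empty.\<close>

definition move_left :: fprog where
  "move_left = FFor ''x'' (FCond (In_top ''x'')
     (FCond (Equal (Var ''x'') (Var ''z'')) (FWrite ''lvl'' (Var ''x'') (Const 0))
       (FCond (At ''mark'' ''x'') (FWrite ''lvl'' (Var ''x'') (Add (Var ''sp'') (Var ''right''))) FSkip))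
     FSkip)"

definition nums :: "nat list \<Rightarrow> rexp list" where
  "nums = map Const"

text \<open>The nine operators of \<open>glue\<close>, outermost first, three numbers each.\<close>

definition glue_code :: "nat list" where
  "glue_code = [2,5,1, 2,4,2, 2,3,1, 3,1,3, 3,2,4, 3,1,4, 3,1,5, 3,3,5, 3,2,5]"

text \<open>Only the codes of the left and then the right part are missing afterwards, in just the
  order in which the stack yields them.\<close>

definition emit_node :: fprog where
  "emit_node = FCond (Or (Var ''left'') (Var ''right''))
     (FSeq (emits (nums glue_code @ [Const 1, Const 0, Const 5, Var ''z'']))
     (FSeq (FCond (And (Var ''left'') (Var ''right'')) (emits [Const 1]) FSkip)
       (FCond (Var ''left'') (emits (nums [2,1,3, 2,2,4])) FSkip)))
     (emits [Const 0, At ''col'' ''z'', Var ''z''])"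

text \<open>The search for a pivot keeps the initial choice of \<open>z\<close> only if the top level contains no
  vertex of \<open>A\<close>, and then it consists of \<open>z\<close> alone.\<close>

definition step :: fprog where
  "step = FSeq (Sel ''z'' ''y'' (In_top ''y'')) (FSeq find_pivot (FSeq mark_left (FSeq move_left (FSeq emit_node
     (FWrite ''sp'' (Const 0) (Sub (Add (Var ''sp'') (Add (Var ''left'') (Var ''right''))) (Const 1)))))))"

lemma main_simps [simp]:
  "writes is_pivot = {''bad'', ''x'', ''p'', ''q'', ''b''}" "wf_fprog is_pivot" "fdepth is_pivot = 2"
  "writes find_pivot = {''bad'', ''x'', ''p'', ''q'', ''b'', ''y'', ''z''}" "wf_fprog find_pivot" "fdepth find_pivot = 3"
  "writes mark_left = {''left'', ''right'', ''x'', ''p'', ''b'', ''mark''}" "wf_fprog mark_left" "fdepth mark_left = 2"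
  "writes move_left = {''x'', ''lvl''}" "wf_fprog move_left" "fdepth move_left = 1"
  by (auto simp: is_pivot_def find_pivot_def mark_left_def move_left_def)

lemma emit_node_simps [simp]:
  "writes emit_node \<subseteq> {''out'', ''outlen''}" "wf_fprog emit_node" "fdepth emit_node = 0"
  using writes_emits by (auto simp: emit_node_def simp del: emits.simps)

lemma frame_emit_node [simp]: "y \<noteq> ''out'' \<Longrightarrow> y \<noteq> ''outlen'' \<Longrightarrow> fexec emit_node s y = s y"
  using emit_node_simps(1) by (intro fexec_frame) blast

lemma step_simps [simp]: "wf_fprog step" "fdepth step = 3" "''n'' \<notin> writes step" "''i'' \<notin> writes step"
  using subsetD[OF emit_node_simps(1), of "''n''"] subsetD[OF emit_node_simps(1), of "''i''"]
  by (auto simp: step_def)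

section \<open>Correctness of the steps of one splitting round\<close>

locale coloured = cobip E A B for E :: "nat set set" and A B +
  fixes N :: nat
  assumes AB: "A \<union> B = {..<N}"
begin

definition ready :: "store \<Rightarrow> bool" where
  "ready s \<longleftrightarrow> base E N s \<and> (\<forall>u < N. s ''col'' u = lab u)"

definition level :: "store \<Rightarrow> nat \<Rightarrow> nat set" where
  "level s i = {u. u < N \<and> s ''lvl'' u = i}"

lemma ready_base: "ready s \<Longrightarrow> base E N s" and ready_n: "ready s \<Longrightarrow> s ''n'' 0 = N"
  by (auto simp: ready_def dest: base_n)

lemma ready_fexec [simp]:
  "''n'' \<notin> writes p \<Longrightarrow> ''row'' \<notin> writes p \<Longrightarrow> ''adj'' \<notin> writes p \<Longrightarrow> ''col'' \<notin> writes p \<Longrightarrow>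
     ready (fexec p s) \<longleftrightarrow> ready s"
  by (simp add: ready_def)

lemma ready_upd [simp]:
  "y \<noteq> ''n'' \<Longrightarrow> y \<noteq> ''row'' \<Longrightarrow> y \<noteq> ''adj'' \<Longrightarrow> y \<noteq> ''col'' \<Longrightarrow> ready (store_upd s y i v) \<longleftrightarrow> ready s"
  by (simp add: ready_def)

lemma level_cong: "s ''lvl'' = s' ''lvl'' \<Longrightarrow> level s = level s'"
  by (simp add: level_def fun_eq_iff)

lemma level_upd [simp]: "y \<noteq> ''lvl'' \<Longrightarrow> level (store_upd s y i v) = level s"
  and level_fexec [simp]: "''lvl'' \<notin> writes p \<Longrightarrow> level (fexec p s) = level s"
  by (simp_all add: level_def fun_eq_iff)

lemma rval_In_top: "s x 0 < N \<Longrightarrow> rval (In_top x) s = of_bool (s x 0 \<in> level s (s ''sp'' 0))"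
  by (simp add: In_top_def level_def)

lemma rval_In_B:
  "ready s \<Longrightarrow> s x 0 < N \<Longrightarrow> rval (In_B x) s = of_bool (s x 0 \<in> B \<inter> level s (s ''sp'' 0))"
  using AB disj by (auto simp: In_B_def In_top_def level_def ready_def lab_def)

lemma col_A: "ready s \<Longrightarrow> u < N \<Longrightarrow> s ''col'' u = Suc 0 \<longleftrightarrow> u \<in> A"
  by (simp add: ready_def lab_def)

lemma is_pivot:
  assumes r: "ready s" and y: "s ''y'' 0 = y" "y \<in> A" "y \<in> level s (s ''sp'' 0)"
  shows "fexec is_pivot s ''bad'' 0 = of_bool (\<not> pivot (level s (s ''sp'' 0)) y)"
proof -
  define m S where "m = s ''sp'' 0" and "S = level s m"
  have yN: "y < N" using y by (simp add: level_def)
  define P where "P x \<longleftrightarrow> x \<in> A \<inter> S \<and> x \<noteq> y \<and> (\<exists>b \<in> B \<inter> S. nonadj E b y \<and> nonadj E b x) \<and>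
        (\<exists>b \<in> B \<inter> S. \<not> nonadj E b y \<and> \<not> nonadj E b x)" for x
  define I where "I k s' \<longleftrightarrow> ready s' \<and> s' ''lvl'' = s ''lvl'' \<and> s' ''sp'' 0 = m \<and> s' ''y'' 0 = y \<and>
    s' ''bad'' 0 = of_bool (\<exists>x < k. P x)" for k s'
  have SN: "b < N" if "b \<in> S" for b using that by (simp add: S_def level_def)
  have "I N (fexec is_pivot s)"
    unfolding is_pivot_def fexec.simps(3)
  proof (rule fexec_FFor[where I = I])
    fix x s' assume x: "x < N" and I: "I x s'"
    let ?s = "store_upd s' ''x'' 0 x"
    let ?p = "Any ''p'' ''b'' (And (In_B ''b'') (And (NonE ''b'' ''y'') (NonE ''b'' ''x'')))"
    let ?q = "Any ''q'' ''b'' (And (In_B ''b'') (And (Not (NonE ''b'' ''y'')) (Not (NonE ''b'' ''x''))))"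
    have r': "ready s'" and y': "s' ''y'' 0 = y" and l: "level s' m = S" "s' ''sp'' 0 = m"
      using I level_cong[of s' s] by (auto simp: I_def S_def)
    note rv = rval_In_B rval_NonE[where E = E and N = N] ready_base
    have p: "fexec ?p ?s ''p'' 0 = of_bool (\<exists>b < N. b \<in> B \<inter> S \<and> nonadj E b y \<and> nonadj E b x)"
      by (rule fexec_Any_iff) (use r' y' l x yN ready_n[OF r'] in \<open>(simp_all add: rv, blast?)\<close>)
    have q: "fexec ?q (fexec ?p ?s) ''q'' 0 = of_bool (\<exists>b < N. b \<in> B \<inter> S \<and> \<not> nonadj E b y \<and> \<not> nonadj E b x)"
      by (rule fexec_Any_iff) (use r' y' l x yN ready_n[OF r'] in \<open>(simp_all add: rv, blast?)\<close>)
    have "rval (In_top ''x'') ?s = of_bool (x \<in> S)"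
      using x l by (simp add: rval_In_top)
    moreover have "P x \<longleftrightarrow> x \<in> A \<and> x \<in> S \<and> x \<noteq> y \<and> fexec ?p ?s ''p'' 0 \<noteq> 0 \<and> fexec ?q (fexec ?p ?s) ''q'' 0 \<noteq> 0"
      unfolding p q P_def using SN by auto
    ultimately show "I (Suc x) (fexec (FCond (And (In_top ''x'') (And (Equal (At ''col'' ''x'') (Const 1)) (Not (Equal (Var ''x'') (Var ''y'')))))
       (FSeq ?p (FSeq ?q (FCond (And (Var ''p'') (Var ''q'')) (FWrite ''bad'' (Const 0) (Const 1)) FSkip)))
       FSkip) ?s)"
      using I x r' y' col_A[OF r', of x]
      by (auto simp: I_def less_Suc_eq)
  qed (use assms in \<open>auto simp: I_def m_def dest: ready_n\<close>)
  moreover have "(\<exists>x < N. P x) \<longleftrightarrow> \<not> pivot S y"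
    using y SN unfolding pivot_def P_def S_def m_def by blast
  ultimately show ?thesis by (simp add: I_def S_def m_def)
qed

lemma find_pivot:
  assumes r: "ready s"
  defines "S \<equiv> level s (s ''sp'' 0)" and "z \<equiv> fexec find_pivot s ''z'' 0"
  shows "pivot S z \<or> (z = s ''z'' 0 \<and> (\<forall>y. \<not> pivot S y))"
proof -
  define m where "m = s ''sp'' 0"
  define I where "I k s' \<longleftrightarrow> ready s' \<and> s' ''lvl'' = s ''lvl'' \<and> s' ''sp'' 0 = m \<and>
    (pivot S (s' ''z'' 0) \<or> (s' ''z'' 0 = s ''z'' 0 \<and> (\<forall>y < k. \<not> pivot S y)))" for k s'
  have piv: "pivot S y \<Longrightarrow> y \<in> A \<and> y \<in> S \<and> y < N" for y by (auto simp: pivot_def S_def level_def)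
  have "I N (fexec find_pivot s)"
    unfolding find_pivot_def
  proof (rule fexec_FFor[where I = I])
    fix y s' assume y: "y < N" and I: "I y s'"
    let ?s = "store_upd s' ''y'' 0 y"
    have r': "ready ?s" and l: "level ?s m = S" "?s ''sp'' 0 = m"
      using I level_cong[of ?s s] by (auto simp: I_def S_def m_def)
    have "rval (In_top ''y'') ?s = of_bool (y \<in> S)"
      using y l by (simp add: rval_In_top)
    moreover have "fexec is_pivot ?s ''bad'' 0 = of_bool (\<not> pivot S y)" if "y \<in> A" "y \<in> S"
      using is_pivot[OF r', of y] that l by simp
    ultimately show "I (Suc y) (fexec (FCond (And (In_top ''y'') (Equal (At ''col'' ''y'') (Const 1)))
     (FSeq is_pivot (FCond (Var ''bad'') FSkip (FWrite ''z'' (Const 0) (Var ''y'')))) FSkip) ?s)"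
      using I y r' piv[of y] col_A[OF r' y]
      by (auto simp: I_def less_Suc_eq)
  qed (use r in \<open>auto simp: I_def m_def dest: ready_n\<close>)
  then show ?thesis using piv by (auto simp: I_def z_def)
qed

lemma mark_left:
  assumes r: "ready s" and z: "s ''z'' 0 = z" "z < N"
  defines "S \<equiv> level s (s ''sp'' 0)" and "s' \<equiv> fexec mark_left s"
  shows "s' ''left'' 0 = of_bool (lpart S z \<noteq> {})" "s' ''right'' 0 = of_bool (rpart S z \<noteq> {})"
    "\<And>x. x \<in> S \<Longrightarrow> x \<noteq> z \<Longrightarrow> s' ''mark'' x \<noteq> 0 \<longleftrightarrow> x \<in> lpart S z"
proof -
  define m where "m = s ''sp'' 0"
  have SN: "b < N" if "b \<in> S" for b using that by (simp add: S_def level_def)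
  define I where "I k s' \<longleftrightarrow> ready s' \<and> s' ''lvl'' = s ''lvl'' \<and> s' ''sp'' 0 = m \<and> s' ''z'' 0 = z \<and>
    s' ''left'' 0 = of_bool (\<exists>x < k. x \<in> lpart S z) \<and> s' ''right'' 0 = of_bool (\<exists>x < k. x \<in> rpart S z) \<and>
    (\<forall>x < k. x \<in> S \<longrightarrow> x \<noteq> z \<longrightarrow> (s' ''mark'' x \<noteq> 0 \<longleftrightarrow> x \<in> lpart S z))" for k s'
  have "I N s'"
    unfolding s'_def mark_left_def fexec.simps(3)
  proof (rule fexec_FFor[where I = I])
    fix x s' assume x: "x < N" and I: "I x s'"
    let ?s = "store_upd s' ''x'' 0 x"
    let ?p = "Any ''p'' ''b'' (And (In_B ''b'') (And (NonE ''b'' ''z'') (Or (NonE ''b'' ''x'') (Equal (Var ''b'') (Var ''x'')))))"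
    have r': "ready s'" and z': "s' ''z'' 0 = z" and l: "level s' m = S" "s' ''sp'' 0 = m"
      using I level_cong[of s' s] by (auto simp: I_def S_def m_def)
    note rv = rval_In_B rval_NonE[where E = E and N = N] ready_base
    have p: "fexec ?p ?s ''p'' 0 = of_bool (\<exists>b < N. b \<in> B \<inter> S \<and> nonadj E b z \<and> (nonadj E b x \<or> b = x))"
      by (rule fexec_Any_iff) (use r' z' z(2) l x ready_n[OF r'] in \<open>(simp_all add: rv, blast?)\<close>)
    have "rval (In_top ''x'') ?s = of_bool (x \<in> S)"
      using x l by (simp add: rval_In_top)
    moreover have "x \<in> lpart S z \<longleftrightarrow> x \<in> S \<and> x \<noteq> z \<and> fexec ?p ?s ''p'' 0 \<noteq> 0"
      "x \<in> rpart S z \<longleftrightarrow> x \<in> S \<and> x \<noteq> z \<and> fexec ?p ?s ''p'' 0 = 0"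
      unfolding p using SN by (auto simp: lpart_def rpart_def)
    ultimately have x_in: "rval (In_top ''x'') ?s = of_bool (x \<in> S)"
      "x \<in> lpart S z \<longleftrightarrow> x \<in> S \<and> x \<noteq> z \<and> fexec ?p ?s ''p'' 0 \<noteq> 0"
      "x \<in> rpart S z \<longleftrightarrow> x \<in> S \<and> x \<noteq> z \<and> fexec ?p ?s ''p'' 0 = 0" by blast+
    let ?body = "FCond (And (In_top ''x'') (Not (Equal (Var ''x'') (Var ''z''))))
       (FSeq ?p (FSeq (FWrite ''mark'' (Var ''x'') (Var ''p''))
         (FCond (Var ''p'') (FWrite ''left'' (Const 0) (Const 1)) (FWrite ''right'' (Const 0) (Const 1)))))
       FSkip"
    consider "x \<in> S \<and> x \<noteq> z" "fexec ?p ?s ''p'' 0 = 0" | "x \<in> S \<and> x \<noteq> z" "fexec ?p ?s ''p'' 0 \<noteq> 0"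
      | "\<not> (x \<in> S \<and> x \<noteq> z)" by blast
    then show "I (Suc x) (fexec ?body ?s)"
      by cases (use I x_in z' in \<open>simp_all add: I_def Ex_less_Suc All_less_Suc\<close>)
  qed (use r z in \<open>auto simp: I_def m_def dest: ready_n\<close>)
  then have I: "I N s'" .
  have "lpart S z \<subseteq> {..<N}" "rpart S z \<subseteq> {..<N}" using SN by (auto simp: lpart_def rpart_def)
  then have "(\<exists>x < N. x \<in> lpart S z) \<longleftrightarrow> lpart S z \<noteq> {}" "(\<exists>x < N. x \<in> rpart S z) \<longleftrightarrow> rpart S z \<noteq> {}"
    by blast+
  then show "s' ''left'' 0 = of_bool (lpart S z \<noteq> {})" "s' ''right'' 0 = of_bool (rpart S z \<noteq> {})"
    "\<And>x. x \<in> S \<Longrightarrow> x \<noteq> z \<Longrightarrow> s' ''mark'' x \<noteq> 0 \<longleftrightarrow> x \<in> lpart S z"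
    using I SN by (auto simp: I_def)
qed

lemma move_left:
  assumes n: "s ''n'' 0 = N" and u: "u < N"
  shows "fexec move_left s ''lvl'' u =
    (if s ''lvl'' u = s ''sp'' 0 then if u = s ''z'' 0 then 0
      else if s ''mark'' u \<noteq> 0 then s ''sp'' 0 + s ''right'' 0 else s ''lvl'' u else s ''lvl'' u)"
proof -
  define f where "f u = (if s ''lvl'' u = s ''sp'' 0 then if u = s ''z'' 0 then 0
      else if s ''mark'' u \<noteq> 0 then s ''sp'' 0 + s ''right'' 0 else s ''lvl'' u else s ''lvl'' u)" for u
  define I where "I k s' \<longleftrightarrow> s' ''sp'' = s ''sp'' \<and> s' ''z'' = s ''z'' \<and> s' ''mark'' = s ''mark'' \<and>
    s' ''right'' = s ''right'' \<and> (\<forall>u. s' ''lvl'' u = (if u < k then f u else s ''lvl'' u))" for k s'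
  have "I N (fexec move_left s)"
    unfolding move_left_def
    by (rule fexec_FFor[where I = I]) (use n in \<open>auto simp: I_def f_def In_top_def less_Suc_eq\<close>)
  then show ?thesis using u by (simp add: I_def f_def)
qed

end

lemma emit_node:
  assumes "has_output s xs"
  shows "has_output (fexec emit_node s) (xs @
    (if s ''left'' 0 = 0 \<and> s ''right'' 0 = 0 then [0, s ''col'' (s ''z'' 0), s ''z'' 0]
     else glue_code @ [1, 0, 5, s ''z'' 0] @ (if s ''left'' 0 \<noteq> 0 \<and> s ''right'' 0 \<noteq> 0 then [1] else []) @
       (if s ''left'' 0 \<noteq> 0 then [2, 1, 3, 2, 2, 4] else [])))"
proof (cases "s ''left'' 0 = 0 \<and> s ''right'' 0 = 0")
  case True
  then show ?thesis
    using output_emits[OF assms, of "[Const 0, At ''col'' ''z'', Var ''z'']"]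
    by (simp add: emit_node_def del: emits.simps)
next
  case False
  have nums: "map (\<lambda>a. rval a s) (nums ns) = ns" "\<forall>a \<in> set (nums ns). reads a = {}" for s ns
    by (auto simp: nums_def o_def)
  let ?as = "nums glue_code @ [Const 1, Const 0, Const 5, Var ''z'']"
  define s1 where "s1 = fexec (emits ?as) s"
  define s2 where "s2 = fexec (FCond (And (Var ''left'') (Var ''right'')) (emits [Const 1]) FSkip) s1"
  have 1: "has_output s1 (xs @ glue_code @ [1, 0, 5, s ''z'' 0])"
    using output_emits[OF assms, of ?as] nums(2) by (auto simp: s1_def nums(1))
  have lr1: "s1 y = s y" if "y \<noteq> ''out''" "y \<noteq> ''outlen''" for y
    using that unfolding s1_def by (rule frame_emits)
  have 2: "has_output s2 ((xs @ glue_code @ [1, 0, 5, s ''z'' 0]) @ (if s ''left'' 0 \<noteq> 0 \<and> s ''right'' 0 \<noteq> 0 then [1] else []))"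
    using 1 output_emits[OF 1, of "[Const 1]"] by (simp add: s2_def lr1 del: emits.simps)
  have lr2: "s2 y = s y" if "y \<noteq> ''out''" "y \<noteq> ''outlen''" for y
    using that lr1[OF that] by (simp add: s2_def del: emits.simps)
  have "fexec emit_node s = fexec (FCond (Var ''left'') (emits (nums [2,1,3, 2,2,4])) FSkip) s2"
    using False by (auto simp: emit_node_def s1_def s2_def simp del: emits.simps)
  then show ?thesis
    using False 2 output_emits[OF 2, of "nums [2,1,3, 2,2,4]"] nums(2)
    by (auto simp: lr2 nums(1) simp del: emits.simps)
qed

lemma encode_glue: "encode (glue e) = glue_code @ encode e" for e :: "nat cw_expr"
  by (simp add: glue_def glue_code_def)

lemma encode_shift_lab: "encode (shift_lab e) = [2, 1, 3, 2, 2, 4] @ encode e" for e :: "nat cw_expr"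
  by (simp add: shift_lab_def)

definition decompose :: fprog where
  "decompose = FSeq (FFor ''u'' (FWrite ''lvl'' (Var ''u'') (Const 1)))
     (FSeq (FWrite ''sp'' (Const 0) (Const 1)) (FFor ''i'' step))"

section \<open>The stack of pending parts and its invariant\<close>

context coloured
begin

definition stack_code :: "(nat \<Rightarrow> nat cw_expr) \<Rightarrow> nat \<Rightarrow> nat list" where
  "stack_code es m = concat (map (\<lambda>i. encode (es i)) (rev [1..<Suc m]))"

lemma stack_code_Suc: "stack_code es (Suc m) = encode (es (Suc m)) @ stack_code es m"
  by (simp add: stack_code_def)

lemma stack_code_cong: "(\<And>i. i \<in> {1..m} \<Longrightarrow> es i = fs i) \<Longrightarrow> stack_code es m = stack_code fs m"
  unfolding stack_code_def by (intro arg_cong[of _ _ concat] map_cong) auto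

text \<open>The parts on the stack are still to be output, the topmost one first; any expressions that
  realize them have to complete the output \<open>xs\<close> to the code of an expression of the whole graph.\<close>

definition completes :: "(nat \<Rightarrow> nat set) \<Rightarrow> nat \<Rightarrow> nat list \<Rightarrow> bool" where
  "completes S m xs \<longleftrightarrow> (\<forall>es. (\<forall>i \<in> {1..m}. realizes (S i) (es i)) \<longrightarrow>
     (\<exists>e. realizes {..<N} e \<and> encode e = xs @ stack_code es m))"

lemma completesD:
  assumes "completes S (Suc m) xs" "realizes (S (Suc m)) d" "\<And>i. i \<in> {1..m} \<Longrightarrow> realizes (S i) (es i)"
  shows "\<exists>e. realizes {..<N} e \<and> encode e = xs @ encode d @ stack_code es m"
proof -
  let ?es = "es(Suc m := d)"
  have "\<forall>i \<in> {1..Suc m}. realizes (S i) (?es i)" using assms(2,3) by auto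
  then obtain e where "realizes {..<N} e" "encode e = xs @ stack_code ?es (Suc m)"
    using assms(1) unfolding completes_def by blast
  moreover have "stack_code ?es m = stack_code es m" by (rule stack_code_cong) auto
  ultimately show ?thesis by (auto simp: stack_code_Suc)
qed

text \<open>Expressions for the new parts are glued into one for \<open>U\<close>, to which the old
  \<open>completes\<close> applies. The four claims correspond to the four shapes of the emitted
  code.\<close>

lemma completes_step:
  fixes S :: "nat \<Rightarrow> nat set"
  assumes c: "completes S (Suc m) xs" and U: "S (Suc m) = U" "U \<subseteq> A \<union> B" "z \<in> U"
    and L: "L = lpart U z" and R: "R = rpart U z" and z: "pivot U z \<or> U = {z}"
    and eq: "\<And>i. i \<in> {1..m} \<Longrightarrow> S' i = S i"
  shows "L = {} \<Longrightarrow> R = {} \<Longrightarrow> completes S' m (xs @ [0, lab z, z])"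
    and "L = {} \<Longrightarrow> R \<noteq> {} \<Longrightarrow> S' (Suc m) = R \<Longrightarrow> completes S' (Suc m) (xs @ glue_code @ [1, 0, 5, z])"
    and "L \<noteq> {} \<Longrightarrow> R = {} \<Longrightarrow> S' (Suc m) = L \<Longrightarrow>
      completes S' (Suc m) (xs @ glue_code @ [1, 0, 5, z, 2, 1, 3, 2, 2, 4])"
    and "L \<noteq> {} \<Longrightarrow> R \<noteq> {} \<Longrightarrow> S' (Suc m) = R \<Longrightarrow> S' (Suc (Suc m)) = L \<Longrightarrow>
      completes S' (Suc (Suc m)) (xs @ glue_code @ [1, 0, 5, z, 1, 2, 1, 3, 2, 2, 4])"
proof -
  have part: "U = insert z (L \<union> R)"
    using U(3) unfolding L R by (auto simp: lpart_def rpart_def)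
  have zLR: "z \<notin> L" "z \<notin> R" "L \<inter> R = {}" unfolding L R by (auto simp: lpart_def rpart_def)
  have es: "realizes (S i) (es i)" if "\<forall>i \<in> {1..n}. realizes (S' i) (es i)" "m \<le> n" "i \<in> {1..m}" for es n i
  proof -
    have "realizes (S' i) (es i)" using that by simp
    then show ?thesis using eq[OF that(3)] by simp
  qed
  have piv: "pivot U z" if "L \<noteq> {} \<or> R \<noteq> {}" using that z part zLR by auto
  {
    assume *: "L = {}" "R = {}"
    show "completes S' m (xs @ [0, lab z, z])"
      unfolding completes_def
    proof (intro allI impI)
      fix es assume "\<forall>i \<in> {1..m}. realizes (S' i) (es i)"
      from completesD[OF c _ es[OF this], of "Create (lab z) z"] realizes_Create[of z]
      show "\<exists>e. realizes {..<N} e \<and> encode e = (xs @ [0, lab z, z]) @ stack_code es m"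
        using part U * by simp
    qed
  next
    assume *: "L = {}" "R \<noteq> {}" "S' (Suc m) = R"
    show "completes S' (Suc m) (xs @ glue_code @ [1, 0, 5, z])"
      unfolding completes_def
    proof (intro allI impI)
      fix es assume es': "\<forall>i \<in> {1..Suc m}. realizes (S' i) (es i)"
      let ?d = "glue (Disjoint_Union (Create 5 z) (es (Suc m)))"
      have "realizes R (es (Suc m))" using es' * by auto
      from realizes_glue[OF U(2) piv pre_realizes(1)[OF zLR(1,2) this, unfolded *(1)[symmetric], unfolded L R]]
      have "realizes U ?d" using * by simp
      from completesD[OF c _ es[OF es'], of ?d] this
      show "\<exists>e. realizes {..<N} e \<and> encode e = (xs @ glue_code @ [1, 0, 5, z]) @ stack_code es (Suc m)"
        using U by (simp add: encode_glue stack_code_Suc)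
    qed
  next
    assume *: "L \<noteq> {}" "R = {}" "S' (Suc m) = L"
    show "completes S' (Suc m) (xs @ glue_code @ [1, 0, 5, z, 2, 1, 3, 2, 2, 4])"
      unfolding completes_def
    proof (intro allI impI)
      fix es assume es': "\<forall>i \<in> {1..Suc m}. realizes (S' i) (es i)"
      let ?d = "glue (Disjoint_Union (Create 5 z) (shift_lab (es (Suc m))))"
      have "realizes L (es (Suc m))" using es' * by auto
      from realizes_glue[OF U(2) piv pre_realizes(2)[OF zLR(1,2) this, unfolded *(2)[symmetric], unfolded L R]]
      have "realizes U ?d" using * by simp
      from completesD[OF c _ es[OF es'], of ?d] this
      show "\<exists>e. realizes {..<N} e \<and> encode e = (xs @ glue_code @ [1, 0, 5, z, 2, 1, 3, 2, 2, 4]) @ stack_code es (Suc m)"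
        using U by (simp add: encode_glue encode_shift_lab stack_code_Suc)
    qed
  next
    assume *: "L \<noteq> {}" "R \<noteq> {}" "S' (Suc m) = R" "S' (Suc (Suc m)) = L"
    show "completes S' (Suc (Suc m)) (xs @ glue_code @ [1, 0, 5, z, 1, 2, 1, 3, 2, 2, 4])"
      unfolding completes_def
    proof (intro allI impI)
      fix es assume es': "\<forall>i \<in> {1..Suc (Suc m)}. realizes (S' i) (es i)"
      let ?d = "glue (Disjoint_Union (Create 5 z) (Disjoint_Union (shift_lab (es (Suc (Suc m)))) (es (Suc m))))"
      have "realizes L (es (Suc (Suc m)))" "realizes R (es (Suc m))" using es' * by auto
      from realizes_glue[OF U(2) piv pre_realizes(3)[OF zLR this, unfolded L R]]
      have "realizes U ?d" using * by simp
      from completesD[OF c _ es[OF es'], of ?d] this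
      show "\<exists>e. realizes {..<N} e \<and> encode e =
          (xs @ glue_code @ [1, 0, 5, z, 1, 2, 1, 3, 2, 2, 4]) @ stack_code es (Suc (Suc m))"
        using U by (simp add: encode_glue encode_shift_lab stack_code_Suc)
    qed
  }
qed

text \<open>One vertex leaves the stack per round, so it is empty after \<open>N\<close> rounds.
  Since no level is empty, the round always finds a vertex on top, and at the end \<open>sp\<close>
  must be 0.\<close>

definition inv :: "nat \<Rightarrow> store \<Rightarrow> bool" where
  "inv k s \<longleftrightarrow> ready s \<and> card {u. u < N \<and> s ''lvl'' u \<noteq> 0} = N - k \<and> (\<forall>u < N. s ''lvl'' u \<le> s ''sp'' 0) \<and>
     (\<forall>i \<in> {1..s ''sp'' 0}. level s i \<noteq> {} \<and> one_Sperner (level s i)) \<and>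
     (\<exists>xs. has_output s xs \<and> completes (level s) (s ''sp'' 0) xs)"

lemma step:
  assumes I: "inv k s" and k: "k < N"
  shows "inv (Suc k) (fexec step s)"
proof -
  have r: "ready s" and card: "card {u. u < N \<and> s ''lvl'' u \<noteq> 0} = N - k"
    and le: "\<And>u. u < N \<Longrightarrow> s ''lvl'' u \<le> s ''sp'' 0"
    and lev: "\<And>i. i \<in> {1..s ''sp'' 0} \<Longrightarrow> level s i \<noteq> {} \<and> one_Sperner (level s i)"
    using I by (auto simp: inv_def)
  obtain xs where xs: "has_output s xs" "completes (level s) (s ''sp'' 0) xs"
    using I by (auto simp: inv_def)
  have "card {u. u < N \<and> s ''lvl'' u \<noteq> 0} \<noteq> 0" using card k by simp
  then have "{u. u < N \<and> s ''lvl'' u \<noteq> 0} \<noteq> {}" by (metis card.empty)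
  then have "s ''sp'' 0 \<noteq> 0" using le by force
  then obtain m where m: "s ''sp'' 0 = Suc m" by (cases "s ''sp'' 0") auto
  define U where "U = level s (Suc m)"
  have U: "U \<noteq> {}" "one_Sperner U" using lev[of "Suc m"] m by (auto simp: U_def)
  have UN: "U \<subseteq> {..<N}" by (auto simp: U_def level_def)
  define s1 where "s1 = fexec (Sel ''z'' ''y'' (In_top ''y'')) s"
  define s2 where "s2 = fexec find_pivot s1"
  define s3 where "s3 = fexec mark_left s2"
  define s4 where "s4 = fexec move_left s3"
  define s5 where "s5 = fexec emit_node s4"
  define s6 where "s6 = fexec step s"
  define z where "z = s2 ''z'' 0"
  define L R where "L = lpart U z" and "R = rpart U z"
  have s6: "s6 = store_upd s5 ''sp'' 0 (s5 ''sp'' 0 + (s5 ''left'' 0 + s5 ''right'' 0) - 1)"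
    by (simp add: s6_def step_def s1_def s2_def s3_def s4_def s5_def)
  have r': "ready s1" "ready s2" "ready s3" "ready s4"
    using r by (simp_all add: s1_def s2_def s3_def s4_def)
  have r6: "ready s6"
    using r'(4) by (simp add: s6 s5_def ready_def base_def)
  have sp: "s1 ''sp'' 0 = Suc m" "s2 ''sp'' 0 = Suc m" "s3 ''sp'' 0 = Suc m" "s4 ''sp'' 0 = Suc m" "s5 ''sp'' 0 = Suc m"
    using m by (simp_all add: s1_def s2_def s3_def s4_def s5_def)
  have lU: "level s1 (Suc m) = U" "level s2 (Suc m) = U" "s3 ''lvl'' = s ''lvl''"
    by (simp_all add: s1_def s2_def s3_def U_def)
  have "rval (In_top ''y'') (store_upd s ''y'' 0 k) \<noteq> 0 \<longleftrightarrow> k \<in> U" if "k < N" for k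
    using that m by (simp add: rval_In_top U_def)
  then have z1: "s1 ''z'' 0 \<in> U"
    using fexec_Sel[of "''z''" "''y''" "In_top ''y''" "s1 ''z'' 0" s, unfolded ready_n[OF r]] U(1) UN
    by (auto simp: s1_def[symmetric])
  have piv: "pivot U z \<or> (z = s1 ''z'' 0 \<and> (\<forall>y. \<not> pivot U y))"
    using find_pivot[OF r'(1)] sp lU by (simp add: s2_def z_def)
  have z: "z \<in> U" "pivot U z \<or> U = {z}"
  proof -
    show zU: "z \<in> U" using piv z1 by (auto simp: pivot_def)
    show "pivot U z \<or> U = {z}"
    proof (cases "pivot U z")
      case False
      then have "A \<inter> U = {}" using piv pivot_exists[OF U(2)] by blast
      then show ?thesis using one_Sperner_no_A[OF U(2) _ _ zU] UN AB by simp
    qed simp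
  qed
  have zN: "z < N" using z UN by auto
  have zz: "s2 ''z'' 0 = z" "s3 ''z'' 0 = z" "s4 ''z'' 0 = z"
    by (simp_all add: s3_def s4_def z_def)
  have LR: "U = insert z (L \<union> R)" "z \<notin> L" "z \<notin> R" "L \<inter> R = {}"
    using z(1) unfolding L_def R_def by (auto simp: lpart_def rpart_def)
  have left: "s3 ''left'' 0 = of_bool (L \<noteq> {})" "s3 ''right'' 0 = of_bool (R \<noteq> {})"
    and mark: "\<And>x. x \<in> U \<Longrightarrow> x \<noteq> z \<Longrightarrow> s3 ''mark'' x \<noteq> 0 \<longleftrightarrow> x \<in> L"
    using mark_left[OF r'(2) zz(1) zN] sp lU by (simp_all add: s3_def L_def R_def)
  have lr: "s4 ''left'' 0 = of_bool (L \<noteq> {})" "s4 ''right'' 0 = of_bool (R \<noteq> {})"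
    "s5 ''left'' 0 = of_bool (L \<noteq> {})" "s5 ''right'' 0 = of_bool (R \<noteq> {})"
    using left by (simp_all add: s4_def s5_def)
  have lvl6: "s6 ''lvl'' u = (if u \<in> U then if u = z then 0 else if u \<in> L then Suc m + of_bool (R \<noteq> {}) else Suc m
      else s ''lvl'' u)" if "u < N" for u
  proof -
    have "u \<in> U \<longleftrightarrow> s ''lvl'' u = Suc m" using that by (simp add: U_def level_def)
    then show ?thesis
      using move_left[where s = s3 and u = u, OF ready_n[OF r'(3)] that] mark[of u] left(2) sp lU(3) zz
      by (simp add: s6 s5_def s4_def)
  qed
  have sp6: "s6 ''sp'' 0 = m + of_bool (L \<noteq> {}) + of_bool (R \<noteq> {})"
    by (simp add: s6 sp lr)
  have level6: "level s6 i = level s i" if "i \<in> {1..m}" for i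
    using that lvl6 by (auto simp: level_def U_def split: if_splits)
  have top: "level s6 (Suc m) = (if R = {} then L else R)"
  proof -
    have "u \<in> level s6 (Suc m) \<longleftrightarrow> u \<in> (if R = {} then L else R)" for u
    proof (cases "u \<in> U")
      case True
      then have "u < N" "u \<in> L \<Longrightarrow> u \<notin> R" "u = z \<or> u \<in> L \<or> u \<in> R" using UN LR by auto
      then show ?thesis using lvl6[of u] True LR(2,3)
        by (cases "R = {}"; cases "u = z"; cases "u \<in> L") (simp_all add: level_def)
    next
      case False
      then show ?thesis using lvl6[of u] LR by (auto simp: level_def U_def)
    qed
    then show ?thesis by blast
  qed
  have top2: "level s6 (Suc (Suc m)) = L" if "R \<noteq> {}"
  proof -
    have "u \<in> level s6 (Suc (Suc m)) \<longleftrightarrow> u \<in> L" for u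
    proof (cases "u \<in> U")
      case True
      then have "u < N" "u = z \<or> u \<in> L \<or> u \<in> R" using UN LR by auto
      then show ?thesis using lvl6[of u] True LR(2,3) that
        by (cases "u = z"; cases "u \<in> L") (simp_all add: level_def)
    next
      \<comment> \<open>Outside \<open>U\<close> the levels are unchanged, and none exceeded
        \<open>Suc m\<close> before.\<close>
      case False
      then show ?thesis using lvl6[of u] LR le[of u] m by (auto simp: level_def)
    qed
    then show ?thesis by blast
  qed
  have col: "s4 ''col'' z = lab z" using r'(4) zN by (simp add: ready_def)
  have AB': "U \<subseteq> A \<union> B" using UN AB by simp
  note cs = completes_step[OF xs(2)[unfolded m] U_def[symmetric] AB' z(1) L_def R_def z(2), of "level s6", OF level6]
  have "has_output s4 xs"
    using xs(1) by (simp add: has_output_def s1_def s2_def s3_def s4_def)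
  note out = emit_node[OF this, folded s5_def, unfolded zz lr col]
  have out6: "has_output s6 ys \<longleftrightarrow> has_output s5 ys" for ys
    by (simp add: has_output_def s6)
  have "\<exists>ys. has_output s6 ys \<and> completes (level s6) (s6 ''sp'' 0) ys"
    unfolding out6 sp6
    using out cs top top2 by (cases "L = {}"; cases "R = {}") auto
  moreover have "card {u. u < N \<and> s6 ''lvl'' u \<noteq> 0} = N - Suc k"
  proof -
    have "{u. u < N \<and> s6 ''lvl'' u \<noteq> 0} = {u. u < N \<and> s ''lvl'' u \<noteq> 0} - {z}"
      using lvl6 z(1) by (auto simp: U_def level_def split: if_splits)
    moreover have "z \<in> {u. u < N \<and> s ''lvl'' u \<noteq> 0}" using z(1) by (simp add: U_def level_def)
    ultimately show ?thesis using card by simp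
  qed
  moreover have "s6 ''lvl'' u \<le> s6 ''sp'' 0" if "u < N" for u
  proof (cases "u \<in> U")
    case True
    then show ?thesis using LR lvl6[OF that] by (auto simp: sp6)
  next
    case False
    then have "s ''lvl'' u \<noteq> Suc m" using that by (simp add: U_def level_def)
    then show ?thesis using False le[OF that] m lvl6[OF that] by (simp add: sp6)
  qed
  moreover have "level s6 i \<noteq> {} \<and> one_Sperner (level s6 i)" if i: "i \<in> {1..s6 ''sp'' 0}" for i
  proof (cases "i \<le> m")
    case True
    then show ?thesis using i level6[of i] lev[of i] m by auto
  next
    case False
    then have LR': "L \<noteq> {} \<or> R \<noteq> {}" using i by (auto simp: sp6)
    then have "pivot U z" using z LR by auto
    note sub = one_Sperner_parts[OF AB' this U(2), folded L_def R_def]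
    have "i = Suc m \<or> i = Suc (Suc m) \<and> L \<noteq> {} \<and> R \<noteq> {}"
      using False i by (auto simp: sp6 of_bool_def split: if_splits)
    then show ?thesis using sub LR' top top2 by (cases "R = {}") auto
  qed
  ultimately have "inv (Suc k) s6"
    using r6 unfolding inv_def by blast
  then show ?thesis by (simp add: s6_def)
qed

lemma decompose:
  assumes r: "ready s" and out: "has_output s []" and S: "one_Sperner {..<N}" and N: "0 < N"
  shows "\<exists>e. realizes {..<N} e \<and> has_output (fexec decompose s) (encode e)"
proof -
  define s1 where "s1 = store_upd (fexec (FFor ''u'' (FWrite ''lvl'' (Var ''u'') (Const 1))) s) ''sp'' 0 1"
  have n: "s ''n'' 0 = N" using r by (rule ready_n)
  have "\<forall>u < N. fexec (FFor ''u'' (FWrite ''lvl'' (Var ''u'') (Const 1))) s ''lvl'' u = 1"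
    by (rule fexec_FFor[where I = "\<lambda>k s. \<forall>u < k. s ''lvl'' u = 1"]) (use n in \<open>auto simp: less_Suc_eq\<close>)
  then have lvl: "u < N \<Longrightarrow> s1 ''lvl'' u = 1" for u by (simp add: s1_def)
  have sp: "s1 ''sp'' 0 = Suc 0" by (simp add: s1_def)
  have lev: "level s1 (Suc 0) = {..<N}" using lvl by (auto simp: level_def)
  have r1: "ready s1" using r by (simp add: s1_def)
  have "{u. u < N \<and> s1 ''lvl'' u \<noteq> 0} = {..<N}" using lvl by auto
  moreover have "completes (level s1) (Suc 0) []"
    unfolding completes_def
  proof (intro allI impI)
    fix es assume "\<forall>i \<in> {1..Suc 0}. realizes (level s1 i) (es i)"
    then show "\<exists>e. realizes {..<N} e \<and> encode e = [] @ stack_code es (Suc 0)"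
      by (intro exI[of _ "es 1"]) (simp add: lev stack_code_def)
  qed
  moreover have "has_output s1 []" using out by (simp add: has_output_def s1_def)
  ultimately have I0: "inv 0 s1"
    using r1 lvl sp lev S N unfolding inv_def by auto
  have "inv N (fexec (FFor ''i'' step) s1)"
  proof (rule fexec_FFor[where I = inv])
    have upd: "inv k (store_upd s ''i'' 0 v) \<longleftrightarrow> inv k s" for k s v
      by (simp add: inv_def has_output_def)
    fix k s
    show "inv N s \<Longrightarrow> inv N (store_upd s ''i'' 0 N)" by (simp add: upd)
    show "k < N \<Longrightarrow> inv k s \<Longrightarrow> inv (Suc k) (fexec step (store_upd s ''i'' 0 k))"
      by (rule step) (simp_all add: upd)
  qed (use I0 ready_n[OF r1] in auto)
  moreover have "fexec (FFor ''i'' step) s1 = fexec decompose s"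
    by (simp add: decompose_def s1_def)
  ultimately have I: "inv N (fexec decompose s)" by simp
  let ?s = "fexec decompose s"
  have "finite {u. u < N \<and> ?s ''lvl'' u \<noteq> 0}" by simp
  then have "{u. u < N \<and> ?s ''lvl'' u \<noteq> 0} = {}" using I unfolding inv_def by auto
  then have "level ?s i = {}" if "i \<noteq> 0" for i using that by (auto simp: level_def)
  \<comment> \<open>A positive \<open>sp\<close> would require a nonempty level, but no vertex is
    left on any.\<close>
  then have "?s ''sp'' 0 = 0"
    using I unfolding inv_def by (metis One_nat_def atLeastAtMost_iff less_Suc0 less_one not_less order_refl)
  then obtain xs where "has_output ?s xs" "completes (level ?s) 0 xs"
    using I unfolding inv_def by auto
  then show ?thesis unfolding completes_def by (auto simp: stack_code_def)
qed

end

section \<open>The graph classes and the main theorem\<close>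

lemma edges_two_P3:
  "edges two_P3 = {{Inl 0, Inl 1}, {Inl 1, Inl 2}, {Inr 0, Inr 1}, {Inr 1, Inr 2}}"
proof -
  have "edges (path_graph 3) = {{0, 1}, {1, 2}}"
    by (auto simp: path_graph_def less_Suc_eq numeral_3_eq_3 numeral_2_eq_2)
  then show ?thesis by (auto simp: two_P3_def disj_union_def)
qed

lemma verts_two_P3: "verts two_P3 = {Inl 0, Inl 1, Inl 2, Inr 0, Inr 1, Inr 2}"
proof -
  have "{..<3 :: nat} = {0, 1, 2}" by auto
  then show ?thesis by (auto simp: two_P3_def disj_union_def path_graph_def)
qed

lemma edge_graph_compl:
  "{u, v} \<in> edges (graph_compl G) \<longleftrightarrow> u \<in> verts G \<and> v \<in> verts G \<and> nonadj (edges G) u v"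
  by (auto simp: graph_compl_def nonadj_def doubleton_eq_iff insert_commute)

lemma verts_graph_compl [simp]: "verts (graph_compl G) = verts G"
  by (simp add: graph_compl_def)

text \<open>Two elements \<open>a1\<close>, \<open>a2\<close> of one difference and
  \<open>d1\<close>, \<open>d2\<close> of the other give the paths \<open>a1\<close>,
  \<open>b\<close>, \<open>a2\<close> and \<open>d1\<close>, \<open>c\<close>, \<open>d2\<close> in
  the complement. There is no further edge among these six vertices, because both sides are
  independent in the complement.\<close>

lemma no_two_P3:
  fixes G :: "'a ugraph"
  assumes G: "simple_graph G" "\<not> has_induced G (graph_compl two_P3)"
    and cob: "cobip (edges G) A B" and AB: "A \<union> B = verts G" and bc: "b \<in> B" "c \<in> B" "b \<noteq> c"
  shows "card {a \<in> A. nonadj (edges G) b a \<and> \<not> nonadj (edges G) c a} \<le> 1 \<or>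
    card {a \<in> A. nonadj (edges G) c a \<and> \<not> nonadj (edges G) b a} \<le> 1"
proof (rule ccontr)
  interpret cobip "edges G" A B by (rule cob)
  let ?n = "nonadj (edges G)"
  assume not: "\<not> ?thesis"
  have two: "\<exists>x \<in> X. \<exists>y \<in> X. x \<noteq> y" if "X \<subseteq> A" "\<not> card X \<le> 1" for X
    using that finite_subset[OF that(1) fin(1)] card_le_Suc0_iff_eq[of X] by auto
  from two[OF _ conjunct1[OF not[unfolded de_Morgan_disj]]] two[OF _ conjunct2[OF not[unfolded de_Morgan_disj]]]
  obtain a1 a2 d1 d2 where
    a: "a1 \<in> A" "a2 \<in> A" "a1 \<noteq> a2" "?n b a1" "?n b a2" "\<not> ?n c a1" "\<not> ?n c a2" and
    d: "d1 \<in> A" "d2 \<in> A" "d1 \<noteq> d2" "?n c d1" "?n c d2" "\<not> ?n b d1" "\<not> ?n b d2"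
    by blast
  have ne: "a1 \<noteq> d1" "a1 \<noteq> d2" "a2 \<noteq> d1" "a2 \<noteq> d2" using a d by auto
  have neB: "b \<noteq> a1" "b \<noteq> a2" "b \<noteq> d1" "b \<noteq> d2" "c \<noteq> a1" "c \<noteq> a2" "c \<noteq> d1" "c \<noteq> d2"
    using a d bc disj by auto
  define S where "S = {a1, b, a2, d1, c, d2}"
  define f :: "'a \<Rightarrow> nat + nat" where "f v = (if v = a1 then Inl 0 else if v = b then Inl 1 else if v = a2 then Inl 2
    else if v = d1 then Inr 0 else if v = c then Inr 1 else Inr 2)" for v
  have f: "f a1 = Inl 0" "f b = Inl 1" "f a2 = Inl 2" "f d1 = Inr 0" "f c = Inr 1" "f d2 = Inr 2"
    using a d bc ne neB by (auto simp: f_def)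
  have "inj_on f S" unfolding S_def by (auto simp: f)
  moreover have "f ` S = verts two_P3" by (simp add: S_def f verts_two_P3)
  ultimately have bij: "bij_betw f S (verts two_P3)" by (simp add: bij_betw_def)
  have E: "{u, v} \<in> edges G \<longleftrightarrow> u \<noteq> v \<and> \<not> ?n u v" for u v
    using edge[of "{u, v}"] by (auto simp: nonadj_def)
  have n: "?n f1 f2 \<longleftrightarrow> {f1, f2} \<in> {{a1, b}, {b, a2}, {d1, c}, {c, d2}}" if "f1 \<in> S" "f2 \<in> S" "f1 \<noteq> f2" for f1 f2
  proof -
    note adj = a(4,5)[THEN nonadj_swap(1)] d(4,5)[THEN nonadj_swap(1)]
      a(6,7)[THEN nonadj_swap(2)] d(6,7)[THEN nonadj_swap(2)] a d cliqueA cliqueB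
    show ?thesis
      using that[unfolded S_def insert_iff empty_iff]
      by (elim disjE) (simp_all add: doubleton_eq_iff adj bc ne neB ne[symmetric] neB[symmetric]
          a(3)[symmetric] d(3)[symmetric] bc(3)[symmetric])
  qed
  have "{u, v} \<in> edges G \<longleftrightarrow> {f u, f v} \<in> edges (graph_compl two_P3)" if "u \<in> S" "v \<in> S" for u v
  proof (cases "u = v")
    case True
    then show ?thesis using E[of u u] edge_graph_compl[of "f u" "f u" two_P3] by simp
  next
    case False
    have inj: "f ` {u, v} = f ` X \<longleftrightarrow> {u, v} = X" if "X \<subseteq> S" for X
      using \<open>inj_on f S\<close> that \<open>u \<in> S\<close> \<open>v \<in> S\<close> by (intro inj_on_image_eq_iff) auto
    have "edges two_P3 = {f ` {a1, b}, f ` {b, a2}, f ` {d1, c}, f ` {c, d2}}"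
      by (simp add: f edges_two_P3)
    moreover have "f u \<noteq> f v" using False that \<open>inj_on f S\<close> by (auto dest: inj_onD)
    moreover have "f u \<in> verts two_P3" "f v \<in> verts two_P3" using that \<open>f ` S = _\<close> by auto
    moreover have "{f u, f v} \<in> {f ` {a1, b}, f ` {b, a2}, f ` {d1, c}, f ` {c, d2}} \<longleftrightarrow>
        {u, v} \<in> {{a1, b}, {b, a2}, {d1, c}, {c, d2}}"
      using inj[of "{a1, b}"] inj[of "{b, a2}"] inj[of "{d1, c}"] inj[of "{c, d2}"]
      by (simp add: S_def)
    ultimately show ?thesis
      unfolding E edge_graph_compl using n[OF that False] False by (simp only: nonadj_def simp_thms)
  qed
  then have "graph_iso (induced G S) (graph_compl two_P3)"
    unfolding graph_iso_def using bij by (intro exI[of _ f]) (auto simp: induced_def)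
  moreover have "S \<subseteq> verts G" using a d bc AB by (auto simp: S_def)
  ultimately show False using G(2) unfolding has_induced_def by blast
qed

lemma simple_graph_edge:
  assumes "simple_graph G" "d \<in> edges G"
  shows "\<exists>u v. u \<noteq> v \<and> d = {u, v}" "d \<subseteq> verts G"
proof -
  obtain u v where "u \<in> verts G" "v \<in> verts G" "u \<noteq> v" "d = {u, v}"
    using assms unfolding simple_graph_def by meson
  then show "\<exists>u v. u \<noteq> v \<and> d = {u, v}" "d \<subseteq> verts G" by auto
qed

lemma cobip_graph:
  assumes G: "simple_graph G" and AB: "A \<union> B = verts G" "A \<inter> B = {}"
    and "\<And>u v. u \<in> A \<Longrightarrow> v \<in> A \<Longrightarrow> \<not> nonadj (edges G) u v"
    and "\<And>u v. u \<in> B \<Longrightarrow> v \<in> B \<Longrightarrow> \<not> nonadj (edges G) u v"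
  shows "cobip (edges G) A B"
proof
  have "finite (verts G)" using G by (simp add: simple_graph_def)
  then show "finite A" "finite B" using AB(1) by (metis finite_Un)+
qed (use assms simple_graph_edge[OF G] in auto)

text \<open>Both differences are nonempty by the antichain property and one has at most one element
  by \<open>no_two_P3\<close>.\<close>

lemma one_Sperner_graph:
  assumes G: "simple_graph G" "\<not> has_induced G (graph_compl two_P3)"
    and cob: "cobip (edges G) A B" and AB: "A \<union> B = verts G"
    and sperner: "\<And>b c. b \<in> B \<Longrightarrow> c \<in> B \<Longrightarrow> b \<noteq> c \<Longrightarrow>
      \<exists>a \<in> A. nonadj (edges G) b a \<and> \<not> nonadj (edges G) c a"
  shows "cobip.one_Sperner (edges G) A B (verts G)"
proof -
  interpret cobip "edges G" A B by (rule cob)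
  show ?thesis
    unfolding one_Sperner_def
  proof (intro ballI impI)
    fix b c assume "b \<in> B \<inter> verts G" "c \<in> B \<inter> verts G" "b \<noteq> c"
    then have bc: "b \<in> B" "c \<in> B" "b \<noteq> c" "c \<noteq> b" by auto
    have d: "diffN (verts G) b c = {a \<in> A. nonadj (edges G) b a \<and> \<not> nonadj (edges G) c a}" for b c
      using AB by (auto simp: diffN_def)
    have ne: "diffN (verts G) b c \<noteq> {}" "diffN (verts G) c b \<noteq> {}"
      unfolding d using sperner[OF bc(1-3)] sperner[OF bc(2,1,4)] by blast+
    then have "card (diffN (verts G) b c) \<noteq> 0" "card (diffN (verts G) c b) \<noteq> 0"
      using fin by (simp_all add: d)
    then show "diffN (verts G) b c \<noteq> {} \<and> (card (diffN (verts G) b c) = 1 \<or> card (diffN (verts G) c b) = 1)"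
      using ne no_two_P3[OF G cob AB bc(1-3)] unfolding d by linarith
  qed
qed

lemma expr_graph_eq:
  assumes "simple_graph G" "cobip (edges G) A B" "cobip.realizes (edges G) A (verts G) e"
  shows "expr_graph e = G"
proof -
  have "verts (cw_graph e) = verts G" "edges (cw_graph e) = {d \<in> edges G. d \<subseteq> verts G}"
    using assms(3) unfolding cobip.realizes_def[OF assms(2)] by auto
  moreover have "{d \<in> edges G. d \<subseteq> verts G} = edges G"
    using simple_graph_edge(2)[OF assms(1)] by blast
  ultimately show ?thesis by (simp add: expr_graph_def)
qed

lemma right_Sperner_compl:
  assumes "right_Sperner (graph_compl G)"
  obtains A B where "A \<union> B = verts G" "A \<inter> B = {}"
    "\<And>u v. u \<in> A \<Longrightarrow> v \<in> A \<Longrightarrow> \<not> nonadj (edges G) u v"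
    "\<And>u v. u \<in> B \<Longrightarrow> v \<in> B \<Longrightarrow> \<not> nonadj (edges G) u v"
    "\<And>b c. b \<in> B \<Longrightarrow> c \<in> B \<Longrightarrow> b \<noteq> c \<Longrightarrow>
      \<exists>a \<in> A. nonadj (edges G) b a \<and> \<not> nonadj (edges G) c a"
proof -
  obtain A B where bip: "bipartition (graph_compl G) A B"
    and sp: "\<And>u v. u \<in> B \<Longrightarrow> v \<in> B \<Longrightarrow> nbhd (graph_compl G) u \<subseteq> nbhd (graph_compl G) v \<Longrightarrow> u = v"
    using assms unfolding right_Sperner_def by blast
  have AB: "A \<union> B = verts G" "A \<inter> B = {}" using bip by (simp_all add: bipartition_def)
  have cl: "\<not> nonadj (edges G) u v" if "u \<in> A \<and> v \<in> A \<or> u \<in> B \<and> v \<in> B" for u v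
  proof -
    have "{u, v} \<notin> edges (graph_compl G)" using bip that unfolding bipartition_def by blast
    then show ?thesis using that AB(1) by (auto simp: edge_graph_compl)
  qed
  have "\<exists>a \<in> A. nonadj (edges G) b a \<and> \<not> nonadj (edges G) c a"
    if bc: "b \<in> B" "c \<in> B" "b \<noteq> c" for b c
  proof -
    obtain a where "a \<in> nbhd (graph_compl G) b" "a \<notin> nbhd (graph_compl G) c"
      using sp[OF bc(1,2)] bc(3) by blast
    then have "a \<in> verts G" "nonadj (edges G) b a" "\<not> nonadj (edges G) c a"
      using bc AB by (auto simp: nbhd_def edge_graph_compl)
    \<comment> \<open>A non-neighbour of \<open>b\<close> cannot lie in the clique \<open>B\<close>,
      so it is in \<open>A\<close>.\<close>
    then show ?thesis using cl[of b a] AB(1) bc(1) by blast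
  qed
  from that[OF AB _ _ this] cl show thesis by blast
qed

lemma clique_width_le_5:
  fixes G :: "'a ugraph"
  assumes G: "simple_graph G" "verts G \<noteq> {}" "\<not> has_induced G (graph_compl two_P3)"
    and "right_Sperner (graph_compl G)"
  shows "clique_width G \<le> 5"
proof -
  obtain A B where AB: "A \<union> B = verts G" "A \<inter> B = {}"
    "\<And>u v. u \<in> A \<Longrightarrow> v \<in> A \<Longrightarrow> \<not> nonadj (edges G) u v"
    "\<And>u v. u \<in> B \<Longrightarrow> v \<in> B \<Longrightarrow> \<not> nonadj (edges G) u v"
    "\<And>b c. b \<in> B \<Longrightarrow> c \<in> B \<Longrightarrow> b \<noteq> c \<Longrightarrow>
      \<exists>a \<in> A. nonadj (edges G) b a \<and> \<not> nonadj (edges G) c a"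
    by (rule right_Sperner_compl[OF assms(4)]) (rule that)
  have cob: "cobip (edges G) A B" by (rule cobip_graph) (use G AB in auto)
  interpret cobip "edges G" A B by (rule cob)
  have "one_Sperner (verts G)"
    by (rule one_Sperner_graph[OF G(1,3) cob AB(1,5)])
  then obtain e where e: "realizes (verts G) e"
    using realizable[of "verts G"] G(1,2) AB(1) by (auto simp: simple_graph_def)
  then have "expr_graph e = G" "k_expression 5 e"
    using expr_graph_eq[OF G(1) cob] by (simp_all add: realizes_def)
  moreover have "graph_iso G G" unfolding graph_iso_def by (intro exI[of _ id]) simp
  ultimately show ?thesis
    unfolding clique_width_def by (intro Least_le) auto
qed

text \<open>A right-Sperner bipartition has no dominated vertex in \<open>B\<close>, unless some
  vertex of \<open>B\<close> is adjacent to all of \<open>A\<close>: a dominated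
  \<open>u \<in> B\<close> with a non-neighbour in \<open>A\<close> shares it with its dominator,
  which thus lies in \<open>B\<close> and violates the antichain property.\<close>

lemma dominated_first_colouring:
  assumes "right_Sperner (graph_compl G)" "verts G = {..<N}"
  shows "\<exists>c. proper (edges G) N c \<and> (\<forall>u < N. dominated (edges G) N u \<longrightarrow> c u = 1)"
proof -
  let ?n = "nonadj (edges G)"
  obtain A B where AB: "A \<union> B = verts G" "A \<inter> B = {}"
    "\<And>u v. u \<in> A \<Longrightarrow> v \<in> A \<Longrightarrow> \<not> ?n u v" "\<And>u v. u \<in> B \<Longrightarrow> v \<in> B \<Longrightarrow> \<not> ?n u v"
    "\<And>b c. b \<in> B \<Longrightarrow> c \<in> B \<Longrightarrow> b \<noteq> c \<Longrightarrow> \<exists>a \<in> A. ?n b a \<and> \<not> ?n c a"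
    by (rule right_Sperner_compl[OF assms(1)]) (rule that)
  show ?thesis
  proof (cases "\<exists>b \<in> B. \<forall>a \<in> A. \<not> ?n b a")
    \<comment> \<open>An empty member of an antichain is its only one. Hence \<open>G\<close> is
      complete and one colour is enough.\<close>
    case True
    then obtain b where b: "b \<in> B" "\<And>a. a \<in> A \<Longrightarrow> \<not> ?n b a" by blast
    then have "B = {b}" using AB(5)[of b] by blast
    have "\<not> ?n u v" if "u < N" "v < N" for u v
    proof -
      have "u = b \<or> u \<in> A" "v = b \<or> v \<in> A" using that AB(1) assms(2) \<open>B = {b}\<close> by auto
      then show ?thesis using AB(3) b(2) by (metis nonadj_irrefl nonadj_swap(1))
    qed
    then show ?thesis by (intro exI[of _ "\<lambda>_. 1"]) (simp add: proper_def)
  next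
    case False
    define c where "c u = (if u \<in> A then 1 else 2 :: nat)" for u
    have "?n u v \<Longrightarrow> c u \<noteq> c v" if "u < N" "v < N" for u v
    proof -
      have "u \<in> A \<union> B" "v \<in> A \<union> B" using that AB(1) assms(2) by auto
      then show "?n u v \<Longrightarrow> c u \<noteq> c v" using AB(2-4) by (auto simp: c_def)
    qed
    moreover have "u \<in> A" if u: "u < N" "dominated (edges G) N u" for u
    proof (rule ccontr)
      assume "u \<notin> A"
      then have uB: "u \<in> B" using u AB(1) assms(2) by auto
      obtain v where v: "v < N" "v \<noteq> u" "\<And>w. w < N \<Longrightarrow> ?n u w \<Longrightarrow> ?n v w"
        using u by (auto simp: dominated_def)
      obtain a where a: "a \<in> A" "?n u a" using False uB by blast
      have AN: "w < N" if "w \<in> A" for w using that AB(1) assms(2) by auto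
      have "?n v a" using v(3)[OF AN] a by blast
      then have "v \<in> B" using AB(1,3) a v(1) assms(2) by (metis UnE lessThan_iff)
      then show False using AB(5)[OF uB \<open>v \<in> B\<close>] v(2,3) AN by blast
    qed
    ultimately show ?thesis by (intro exI[of _ c]) (auto simp: proper_def c_def)
  qed
qed

section \<open>The complete program\<close>

definition program :: fprog where
  "program = FSeq init_rows (FSeq col_dominated (FSeq colouring decompose))"

lemma program_simps: "wf_fprog program" "fdepth program = 4"
  by (auto simp: program_def init_rows_def col_dominated_def colouring_def decompose_def)

lemma program_correct:
  fixes G :: "nat ugraph"
  assumes G: "simple_graph G" "verts G \<noteq> {}" "\<not> has_induced G (graph_compl two_P3)"
    "right_Sperner (graph_compl G)" and N: "verts G = {..<N}"
  shows "\<exists>e. has_output (fexec program (input_store G)) (encode e) \<and> k_expression 5 e \<and> expr_graph e = G"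
proof -
  let ?E = "edges G" and ?n = "nonadj (edges G)"
  define s0 where "s0 = input_store G"
  define s1 where "s1 = fexec init_rows s0"
  define s2 where "s2 = fexec col_dominated s1"
  define s3 where "s3 = fexec colouring s2"
  have "0 < N" using G(2) N by auto
  have z: "s0 x i = 0" if "x \<noteq> ''n''" "x \<noteq> ''adj''" for x i
    using that by (simp add: s0_def input_store_def)
  have b1: "base ?E N s1" unfolding s1_def s0_def by (rule base_init_rows[OF G(1) N])
  have b2: "base ?E N s2" using b1 by (simp add: s2_def col_dominated_def)
  have b3: "base ?E N s3" using b2 by (simp add: s3_def colouring_def)
  have "s1 ''col'' u = 0" for u by (simp add: s1_def init_rows_def z)
  from col_dominated[OF b1 this] have dom: "s2 ''col'' u = of_bool (dominated ?E N u)" if "u < N" for u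
    using that by (simp add: s2_def)
  obtain c0 where "proper ?E N c0" "\<forall>u < N. dominated ?E N u \<longrightarrow> c0 u = 1"
    using dominated_first_colouring[OF G(4) N] by blast
  then have ext: "extendable ?E N (s2 ''col'')"
    unfolding extendable_def by (intro exI[of _ c0]) (simp add: dom)
  define c where "c = s3 ''col''"
  have c: "proper ?E N c" "\<And>u. u < N \<Longrightarrow> dominated ?E N u \<Longrightarrow> c u = 1"
    using colouring[OF b2 \<open>0 < N\<close> ext] by (auto simp: c_def s3_def dom)
  define A B where "A = {u. u < N \<and> c u = 1}" and "B = {u. u < N \<and> c u = 2}"
  have AB: "A \<union> B = verts G" "A \<inter> B = {}"
    using c(1) N by (auto simp: A_def B_def proper_def)
  have same: "\<not> ?n u v" if "u < N" "v < N" "c u = c v" for u v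
    using c(1) that unfolding proper_def by blast
  have cob: "cobip ?E A B"
    by (rule cobip_graph[OF G(1) AB]) (use same in \<open>simp_all add: A_def B_def\<close>)
  note cover = AB(1)
  interpret coloured ?E A B N
    by (rule coloured.intro[OF cob]) (use AB(1) N in \<open>simp add: coloured_axioms_def\<close>)
  \<comment> \<open>The computed bipartition may differ from the given one, but its \<open>B\<close>
    has no dominated vertices. A witness against domination of \<open>b\<close> by \<open>d\<close>
    is a non-neighbour of \<open>b\<close>, hence in \<open>A\<close>.\<close>
  have "\<exists>a \<in> A. ?n b a \<and> \<not> ?n d a" if bd: "b \<in> B" "d \<in> B" "b \<noteq> d" for b d
  proof -
    have "\<not> dominated ?E N b" using c(2)[of b] bd(1) by (auto simp: B_def)
    then obtain w where w: "w < N" "?n b w" "\<not> ?n d w"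
      using bd by (auto simp: dominated_def B_def)
    then have "w \<in> A" using cliqueB[OF bd(1), of w] AB(1) N by auto
    with w show ?thesis by blast
  qed
  then have "one_Sperner {..<N}" using one_Sperner_graph[OF G(1,3) cob cover] N by simp
  moreover have "c u = lab u" if "u < N" for u
    unfolding lab_def using c(1) that by (auto simp: A_def proper_def)
  then have "ready s3"
    using b3 by (simp add: ready_def c_def[symmetric])
  moreover have "has_output s3 []"
    by (simp add: has_output_def s3_def s2_def s1_def colouring_def col_dominated_def init_rows_def z)
  ultimately obtain e where e: "realizes {..<N} e" "has_output (fexec decompose s3) (encode e)"
    using decompose[of s3] \<open>0 < N\<close> by blast
  then have "expr_graph e = G" "k_expression 5 e"
    using expr_graph_eq[OF G(1) cob] N by (simp_all add: realizes_def)
  with e(2) show ?thesis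
    by (auto simp: program_def s3_def s2_def s1_def s0_def)
qed

theorem theorem6p5:
  "(\<forall>G :: 'a ugraph.
      simple_graph G \<and> verts G \<noteq> {} \<and> cobipartite G \<and>
      \<not> has_induced G (graph_compl two_P3) \<and> right_Sperner (graph_compl G)
      \<longrightarrow> clique_width G \<le> 5) \<and>
   (\<exists>p T. (\<lambda>n. real (T n)) \<in> O(\<lambda>n. real n ^ 4) \<and>
      computes_k_expressions_in_time 5
        {G. simple_graph G \<and> verts G \<noteq> {} \<and> cobipartite G \<and>
            \<not> has_induced G (graph_compl two_P3) \<and> right_Sperner (graph_compl G)} p T)"
proof (intro conjI exI[of _ "compile program"] exI[of _ "fcost program"])
  show "\<forall>G :: 'a ugraph. simple_graph G \<and> verts G \<noteq> {} \<and> cobipartite G \<and>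
      \<not> has_induced G (graph_compl two_P3) \<and> right_Sperner (graph_compl G) \<longrightarrow> clique_width G \<le> 5"
    using clique_width_le_5 by blast
  show "(\<lambda>n. real (fcost program n)) \<in> O(\<lambda>n. real n ^ 4)"
    using fcost_bigo[of program] by (simp only: program_simps)
  show "computes_k_expressions_in_time 5
        {G. simple_graph G \<and> verts G \<noteq> {} \<and> cobipartite G \<and>
            \<not> has_induced G (graph_compl two_P3) \<and> right_Sperner (graph_compl G)} (compile program) (fcost program)"
    unfolding computes_k_expressions_in_time_def
  proof (intro ballI impI)
    fix G :: "nat ugraph"
    assume G: "G \<in> {G. simple_graph G \<and> verts G \<noteq> {} \<and> cobipartite G \<and>
            \<not> has_induced G (graph_compl two_P3) \<and> right_Sperner (graph_compl G)}"
      and N: "verts G = {..<card (verts G)}"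
    have "input_store G ''n'' 0 = card (verts G)" by (simp add: input_store_def)
    from run_compile[where p = program and s = "input_store G", OF program_simps(1) this] obtain t where
      "t \<le> fcost program (card (verts G))" "run (compile program) (input_store G) t (fexec program (input_store G))"
      by blast
    moreover obtain e where "has_output (fexec program (input_store G)) (encode e)" "k_expression 5 e" "expr_graph e = G"
      using program_correct[OF _ _ _ _ N] G by blast
    ultimately show "\<exists>t s e. run (compile program) (input_store G) t s \<and> t \<le> fcost program (card (verts G)) \<and>
        output_is s e \<and> k_expression 5 e \<and> expr_graph e = G"
      unfolding output_is_def has_output_def by blast
  qed
qed

end
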